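(* Let $n \ge 1$ be an integer and let $k, r \in \mathbb{Z}$ with $0 \leq r < n$ and $n \le kn+r$. Then $$ \beta_0(B^3_{n,n,kn+r}) = \begin{cases} 2n + 4 & \text{if } k \text{ is odd, } n \text{ is odd and } r=0,\\ 2n + 3 - r & \text{if } (k \text{ is odd, } n \text{ is odd and } r>0) \text{ or } (k \text{ is odd and } r \text{ is odd}),\\ 2n - r & \text{if } k \text{ is odd and } n \text{ and } r \text{ are even},\\ n + 5 & \text{if } k \text{ is even, } n \text{ is odd and } r=0,\\ n + 3 + r & \text{if } (k \text{ is even, } n \text{ is odd and } r>0) \text{ or } (k \text{ is even and } r \text{ is odd}),\\ n + r & \text{if } k \text{ is even and } n \text{ and } r \text{ are even}. \end{cases} $$
   Context: Let $n, m$ be positive integers with $n \le m$. The board is the surface of an $n \times n \times m$ cuboid (square prism), consisting of two opposite $n\times n$ faces and four $n \times m$ faces, glued along edges in the usual way, with every face subdivided into unit squares in the standard grid. At every grid vertex of the surface other than the 8 corners of the cuboid, exactly four unit squares meet, and they form two pairs of opposite squares; two squares opposite at such a vertex are called diagonally adjacent (through that vertex). This includes vertices lying on an edge of the cuboid, so diagonals continue across edges from face to face. At each of the 8 corners of the cuboid only three squares meet, and there is no diagonal adjacency through a corner. A diagonal is a set of consecutive diagonally adjacent squares: starting from a square and one of its vertices, one passes through that vertex to the opposite square, then leaves that square through the vertex opposite (within that square) to the one by which it was entered, and so on. A path stops when the vertex through which it would leave is a corner of the cuboid. A maximal diagonal is the set of all squares obtained by following such a path in both directions as far as possible. A bishop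 on a square can move in a single move to any other square of any maximal diagonal traversing its square (two maximal diagonals, or directions, cross at each square, one for each of the two pairs of opposite vertices of the square). $B^3_{n,n,m}$ is the graph whose vertices are the unit squares of this surface, two distinct squares being adjacent if a bishop can move from one to the other in a single move, i.e. if they lie on a common maximal diagonal. $\beta_0(G)$ denotes the independence number of a graph $G$, i.e. the maximum cardinality of a set of pairwise non-adjacent vertices. *)

theory Defs
  imports "HOL-Library.Ramsey"
begin

text \<open>
  The board is the surface of the box \<open>[0,a] \<times> [0,b] \<times> [0,c]\<close>. A unit square is represented
  by the set of its four grid vertices, so a square of a face perpendicular to the third axis is
  \<open>{x,x+1} \<times> {y,y+1} \<times> {z}\<close>, and likewise for the other two axes. Distinct unit squares of the
  surface have distinct vertex sets, also when \<open>a\<close>, \<open>b\<close> or \<open>c\<close> equals \<open>1\<close>.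
\<close>

type_synonym vertex = "int \<times> int \<times> int"
type_synonym square = "vertex set"

definition squares :: "int \<Rightarrow> int \<Rightarrow> int \<Rightarrow> square set" where
  "squares a b c =
     {{x, x+1} \<times> {y, y+1} \<times> {z} | x y z. x \<in> {0..<a} \<and> y \<in> {0..<b} \<and> z \<in> {0, c}} \<union>
     {{x, x+1} \<times> {y} \<times> {z, z+1} | x y z. x \<in> {0..<a} \<and> y \<in> {0, b} \<and> z \<in> {0..<c}} \<union>
     {{x} \<times> {y, y+1} \<times> {z, z+1} | x y z. x \<in> {0, a} \<and> y \<in> {0..<b} \<and> z \<in> {0..<c}}"

definition corners :: "int \<Rightarrow> int \<Rightarrow> int \<Rightarrow> vertex set" where
  "corners a b c = {0, a} \<times> {0, b} \<times> {0, c}"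

fun grid_dist :: "vertex \<Rightarrow> vertex \<Rightarrow> int" where
  "grid_dist (x, y, z) (x', y', z') = \<bar>x - x'\<bar> + \<bar>y - y'\<bar> + \<bar>z - z'\<bar>"

text \<open>
  Two vertices of a unit square are at grid distance \<open>1\<close> if they span a side and at grid
  distance \<open>2\<close> if they are opposite.
\<close>

definition opposite_vertices :: "square \<Rightarrow> vertex \<Rightarrow> vertex \<Rightarrow> bool" where
  "opposite_vertices s v w \<longleftrightarrow> v \<in> s \<and> w \<in> s \<and> grid_dist v w = 2"

text \<open>
  Around a grid vertex \<open>v\<close> that is not a corner there are four squares in cyclic order; cyclic
  neighbours share a side, i.e. a second vertex besides \<open>v\<close>, whereas opposite squares have only
  \<open>v\<close> in common.
\<close>

definition diag_adjacent :: "int \<Rightarrow> int \<Rightarrow> int \<Rightarrow> vertex \<Rightarrow> square \<Rightarrow> square \<Rightarrow> bool" where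
  "diag_adjacent a b c v s t \<longleftrightarrow>
     s \<in> squares a b c \<and> t \<in> squares a b c \<and> v \<notin> corners a b c \<and> s \<inter> t = {v}"

text \<open>A state \<open>(s, v)\<close> of a path is a square together with the vertex through which it is left.\<close>

definition diag_step ::
    "int \<Rightarrow> int \<Rightarrow> int \<Rightarrow> ((square \<times> vertex) \<times> (square \<times> vertex)) set" where
  "diag_step a b c =
     {((s, v), (t, w)) | s v t w. diag_adjacent a b c v s t \<and> opposite_vertices t v w}"

text \<open>The path is followed from \<open>s\<close> in both directions, through \<open>v\<close> and through \<open>w\<close>.\<close>

definition maximal_diagonals :: "int \<Rightarrow> int \<Rightarrow> int \<Rightarrow> square set set" where
  "maximal_diagonals a b c =
     {fst ` ((diag_step a b c)\<^sup>* `` {(s, v), (s, w)}) | s v w.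
        s \<in> squares a b c \<and> opposite_vertices s v w}"

definition bishop_graph :: "int \<Rightarrow> int \<Rightarrow> int \<Rightarrow> square set \<times> square set set" where
  "bishop_graph a b c =
     (squares a b c,
      {{s, t} | s t. s \<in> squares a b c \<and> t \<in> squares a b c \<and> s \<noteq> t \<and>
         (\<exists>D \<in> maximal_diagonals a b c. s \<in> D \<and> t \<in> D)})"

text \<open>\<^const>\<open>indep\<close> is the notion of independent set from \<^theory>\<open>HOL-Library.Ramsey\<close>.\<close>

definition independence_number :: "'v set \<times> 'v set set \<Rightarrow> nat" where
  "independence_number G = Max {card S | S. S \<subseteq> fst G \<and> indep S (snd G)}"

end

theory Submission
  imports Defs
begin

text \<open>
  Opposite vertices of a unit square have coordinate sums of the same parity, so a diagonal runs
  through vertices of one parity only. Hence there are even and odd diagonals, and every square lies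
  on exactly one of each: squares are the edges of a bipartite graph whose nodes are the diagonals.
  Pairwise non-attacking bishops form a matching in this graph. So there are at most as many of them
  as there are odd diagonals, and the theorem holds because this bound is always attained.

  To name the diagonals, unroll the four side faces into a cylinder of circumference \<open>4n\<close> and
  height \<open>m = kn + r\<close>, and follow a diagonal in the direction in which the perimeter coordinate
  increases. A path that comes down and enters the bottom face at position \<open>d = jn + a\<close>, where
  \<open>0 < a < n\<close>, leaves it at \<open>turn d = 2n(j+1) - d\<close>, the mirror image of \<open>d\<close> in the next corner. It
  then climbs to position \<open>turn d + m\<close>, is reflected in the same way by the top face, and comes down
  again at \<open>d + 2n(k+2)\<close> if \<open>a < r\<close> and at \<open>d + 2n(k+1)\<close> if \<open>a > r\<close>. Modulo the circumference this
  is \<open>d\<close> or \<open>d + 2n\<close>, depending on the parity of \<open>k\<close>. So the diagonal is determined by its entry \<open>d\<close>,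
  taken modulo \<open>4n\<close> in the first case and modulo \<open>2n\<close> in the second. A diagonal with \<open>a = 0\<close> ends in a
  corner of the bottom, and one with \<open>a = r > 0\<close> climbs to a corner of the top; these diagonals do not
  close up, and their entry is unique modulo \<open>4n\<close>. Diagonals without any entry are the main diagonals
  of the two square faces and, for \<open>r = 0\<close>, the paths that rise from a bottom corner straight to a top
  corner.

  The function \<open>label\<close> computes this name from the coordinates of a square and a parity, and
  \<open>same_diagonal_iff\<close> says that it is a complete invariant. By \<open>independence_number_eqI\<close> it remains to
  exhibit as many squares as there are odd labels, such that labels of either parity are distinct.
  Most of them are taken from one row of the cylinder. If the odd diagonal of a square in
  the row at height \<open>(w - 1) / 2\<close> comes down to the position \<open>d\<close>, then its even diagonal comes up from
  the position \<open>d - w\<close>, so one square for each odd entry works as soon as \<open>d \<mapsto> w - d\<close> sends entries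
  that are counted modulo \<open>4n\<close> to entries that are counted modulo \<open>4n\<close>. For \<open>w\<close>
  congruent to \<open>r\<close> modulo \<open>n\<close> this symmetry is exact; an odd \<open>w\<close> of this kind exists unless \<open>n\<close> and \<open>r\<close>
  are both even, and then \<open>w = r + 1\<close> serves for odd entries.
\<close>

section \<open>Diagonals as connected components\<close>

definition even_vertex :: "vertex \<Rightarrow> bool" where
  "even_vertex = (\<lambda>(x, y, z). even (x + y + z))"

text \<open>
  A step of a path in either direction, through a vertex of parity \<open>p\<close>. The direction of travel is
  forgotten: an undirected relation on squares is easier to follow than \<^const>\<open>diag_step\<close>.
\<close>

definition linked :: "int \<Rightarrow> int \<Rightarrow> int \<Rightarrow> bool \<Rightarrow> square \<Rightarrow> square \<Rightarrow> bool" where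
  "linked a b c p s t \<longleftrightarrow> (\<exists>v. diag_adjacent a b c v s t \<and> even_vertex v = p)"

text \<open>
  A square is a product of three factors, two of them unit segments and the third an end point. Whether two
  squares meet in a single vertex can then be decided on each axis separately.
\<close>

definition unit_segment :: "int \<Rightarrow> int set \<Rightarrow> bool" where
  "unit_segment a I \<longleftrightarrow> (\<exists>x. 0 \<le> x \<and> x < a \<and> I = {x, x+1})"

definition end_point :: "int \<Rightarrow> int set \<Rightarrow> bool" where
  "end_point a I \<longleftrightarrow> I = {0} \<or> I = {a}"

lemma squares_cases:
  assumes "s \<in> squares a b c"
  obtains
    (horizontal) I J K where "s = I \<times> J \<times> K" "unit_segment a I" "unit_segment b J" "end_point c K"
  | (front) I J K where "s = I \<times> J \<times> K" "unit_segment a I" "end_point b J" "unit_segment c K"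
  | (side) I J K where "s = I \<times> J \<times> K" "end_point a I" "unit_segment b J" "unit_segment c K"
proof -
  consider x y z where "s = {x, x+1} \<times> {y, y+1} \<times> {z}" "0 \<le> x" "x < a" "0 \<le> y" "y < b" "z = 0 \<or> z = c"
    | x y z where "s = {x, x+1} \<times> {y} \<times> {z, z+1}" "0 \<le> x" "x < a" "0 \<le> z" "z < c" "y = 0 \<or> y = b"
    | x y z where "s = {x} \<times> {y, y+1} \<times> {z, z+1}" "0 \<le> y" "y < b" "0 \<le> z" "z < c" "x = 0 \<or> x = a"
    using assms unfolding squares_def Un_iff mem_Collect_eq atLeastLessThan_iff insert_iff empty_iff by blast
  then show ?thesis
  proof cases
    case 1
    then show ?thesis
      using horizontal[of "{x, x+1}" "{y, y+1}" "{z}"] unfolding unit_segment_def end_point_def by blast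
  next
    case 2
    then show ?thesis
      using front[of "{x, x+1}" "{y}" "{z, z+1}"] unfolding unit_segment_def end_point_def by blast
  next
    case 3
    then show ?thesis
      using side[of "{x}" "{y, y+1}" "{z, z+1}"] unfolding unit_segment_def end_point_def by blast
  qed
qed

lemma box_meet:
  assumes "A \<times> B \<times> C \<inter> A' \<times> B' \<times> C' = {(x, y, z)}"
  shows "A \<inter> A' = {x}" "B \<inter> B' = {y}" "C \<inter> C' = {z}"
proof -
  have *: "(A \<inter> A') \<times> (B \<inter> B') \<times> (C \<inter> C') = {(x, y, z)}"
    using assms by (simp add: Times_Int_Times)
  have "A \<inter> A' = fst ` {(x, y, z)}" "B \<inter> B' = fst ` snd ` {(x, y, z)}" "C \<inter> C' = snd ` snd ` {(x, y, z)}"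
    unfolding *[symmetric] using * by (auto simp: fst_image_times snd_image_times)
  then show "A \<inter> A' = {x}" "B \<inter> B' = {y}" "C \<inter> C' = {z}" by simp_all
qed

text \<open>
  Two segments that meet in one point lie on the two sides of it, so there is room on both sides.
\<close>

lemma segments_meet_inside:
  assumes "unit_segment a I" "unit_segment a J" "I \<inter> J = {v}"
  shows "v \<noteq> 0" "v \<noteq> a"
proof -
  obtain x y where xy: "0 \<le> x" "x < a" "I = {x, x+1}" "0 \<le> y" "y < a" "J = {y, y+1}"
    using assms(1,2) by (auto simp: unit_segment_def)
  have "v \<in> I" "v \<in> J" "x \<noteq> y" using assms(3) xy by auto
  then show "v \<noteq> 0" "v \<noteq> a" using xy by auto
qed

lemma segment_neighbour_unique:
  assumes "unit_segment a I \<or> end_point a I" "unit_segment a J" "unit_segment a J'"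
    and "I \<inter> J = {v}" "I \<inter> J' = {v}"
  shows "J = J'"
proof -
  obtain y y' where y: "0 \<le> y" "y < a" "J = {y, y+1}" "0 \<le> y'" "y' < a" "J' = {y', y'+1}"
    using assms(2,3) by (auto simp: unit_segment_def)
  have v: "v \<in> I" "v \<in> J" "v \<in> J'" using assms(4,5) by auto
  from assms(1) have "y = y'"
  proof
    assume "unit_segment a I"
    then obtain x where x: "I = {x, x+1}" by (auto simp: unit_segment_def)
    then have "x \<noteq> y" "x \<noteq> y'" using assms(4,5) y by auto
    then show ?thesis using x y v by auto
  next
    assume "end_point a I"
    then show ?thesis using y v by (auto simp: end_point_def)
  qed
  then show ?thesis using y by simp
qed

text \<open>
  On each axis, the factor of \<open>t\<close> is determined by the factor of \<open>s\<close>, the vertex and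
  the kind of the factor of \<open>t\<close>. The kinds are determined as well: an axis on which
  \<open>t\<close> or \<open>u\<close> is an end point has its \<open>v\<close>-coordinate at the boundary, so
  on an axis where exactly one of \<open>t\<close> and \<open>u\<close> is an end point \<open>s\<close> cannot
  be a segment. If the kinds of \<open>t\<close> and \<open>u\<close> differed, there would be two such axes,
  but \<open>s\<close> has only one end point.
\<close>

lemma diagonal_neighbour_unique:
  assumes st: "diag_adjacent a b c v s t" and su: "diag_adjacent a b c v s u"
  shows "t = u"
proof -
  obtain p q h where v: "v = (p, q, h)" by (cases v) auto
  have s: "s \<in> squares a b c" and t: "t \<in> squares a b c" and u: "u \<in> squares a b c"
    and 1: "s \<inter> t = {(p, q, h)}" and 2: "s \<inter> u = {(p, q, h)}"
    using st su by (auto simp: diag_adjacent_def v)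
  obtain I J K where s': "s = I \<times> J \<times> K"
      "unit_segment a I \<or> end_point a I" "unit_segment b J \<or> end_point b J" "unit_segment c K \<or> end_point c K"
      "unit_segment a I \<and> unit_segment b J \<or> unit_segment a I \<and> unit_segment c K \<or> unit_segment b J \<and> unit_segment c K"
    using s by (cases rule: squares_cases) blast+
  have end_v: "i = 0 \<or> i = d" if "end_point d A" "B \<inter> A = {i}" for d i A B
  proof -
    have "i \<in> A" using that(2) by blast
    then show ?thesis using that(1) unfolding end_point_def by blast
  qed
  have end_eq: "A = {i}" if "end_point d A" "B \<inter> A = {i}" for d i A B
  proof -
    have "i \<in> A" using that(2) by blast
    then show ?thesis using that(1) unfolding end_point_def by blast
  qed
  note inside = segments_meet_inside and unique = segment_neighbour_unique
  from t show ?thesis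
  proof (cases rule: squares_cases)
    case t: (horizontal It Jt Kt)
    note m = box_meet[OF 1[unfolded s'(1) t(1)]]
    from u show ?thesis
    proof (cases rule: squares_cases)
      case u: (horizontal Iu Ju Ku)
      note m' = box_meet[OF 2[unfolded s'(1) u(1)]]
      show ?thesis
        using unique[OF s'(2) t(2) u(2) m(1) m'(1)] unique[OF s'(3) t(3) u(3) m(2) m'(2)]
          end_eq[OF t(4) m(3)] end_eq[OF u(4) m'(3)] t(1) u(1) by simp
    next
      case u: (front Iu Ju Ku)
      note m' = box_meet[OF 2[unfolded s'(1) u(1)]]
      have "\<not> unit_segment b J" "\<not> unit_segment c K"
        using inside[OF _ t(3) m(2)] end_v[OF u(3) m'(2)] inside[OF _ u(4) m'(3)] end_v[OF t(4) m(3)] by blast+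
      then show ?thesis using s'(5) by blast
    next
      case u: (side Iu Ju Ku)
      note m' = box_meet[OF 2[unfolded s'(1) u(1)]]
      have "\<not> unit_segment a I" "\<not> unit_segment c K"
        using inside[OF _ t(2) m(1)] end_v[OF u(2) m'(1)] inside[OF _ u(4) m'(3)] end_v[OF t(4) m(3)] by blast+
      then show ?thesis using s'(5) by blast
    qed
  next
    case t: (front It Jt Kt)
    note m = box_meet[OF 1[unfolded s'(1) t(1)]]
    from u show ?thesis
    proof (cases rule: squares_cases)
      case u: (horizontal Iu Ju Ku)
      note m' = box_meet[OF 2[unfolded s'(1) u(1)]]
      have "\<not> unit_segment b J" "\<not> unit_segment c K"
        using inside[OF _ u(3) m'(2)] end_v[OF t(3) m(2)] inside[OF _ t(4) m(3)] end_v[OF u(4) m'(3)] by blast+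
      then show ?thesis using s'(5) by blast
    next
      case u: (front Iu Ju Ku)
      note m' = box_meet[OF 2[unfolded s'(1) u(1)]]
      show ?thesis
        using unique[OF s'(2) t(2) u(2) m(1) m'(1)] unique[OF s'(4) t(4) u(4) m(3) m'(3)]
          end_eq[OF t(3) m(2)] end_eq[OF u(3) m'(2)] t(1) u(1) by simp
    next
      case u: (side Iu Ju Ku)
      note m' = box_meet[OF 2[unfolded s'(1) u(1)]]
      have "\<not> unit_segment a I" "\<not> unit_segment b J"
        using inside[OF _ t(2) m(1)] end_v[OF u(2) m'(1)] inside[OF _ u(3) m'(2)] end_v[OF t(3) m(2)] by blast+
      then show ?thesis using s'(5) by blast
    qed
  next
    case t: (side It Jt Kt)
    note m = box_meet[OF 1[unfolded s'(1) t(1)]]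
    from u show ?thesis
    proof (cases rule: squares_cases)
      case u: (horizontal Iu Ju Ku)
      note m' = box_meet[OF 2[unfolded s'(1) u(1)]]
      have "\<not> unit_segment a I" "\<not> unit_segment c K"
        using inside[OF _ u(2) m'(1)] end_v[OF t(2) m(1)] inside[OF _ t(4) m(3)] end_v[OF u(4) m'(3)] by blast+
      then show ?thesis using s'(5) by blast
    next
      case u: (front Iu Ju Ku)
      note m' = box_meet[OF 2[unfolded s'(1) u(1)]]
      have "\<not> unit_segment a I" "\<not> unit_segment b J"
        using inside[OF _ u(2) m'(1)] end_v[OF t(2) m(1)] inside[OF _ t(3) m(2)] end_v[OF u(3) m'(2)] by blast+
      then show ?thesis using s'(5) by blast
    next
      case u: (side Iu Ju Ku)
      note m' = box_meet[OF 2[unfolded s'(1) u(1)]]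
      show ?thesis
        using unique[OF s'(3) t(3) u(3) m(2) m'(2)] unique[OF s'(4) t(4) u(4) m(3) m'(3)]
          end_eq[OF t(2) m(1)] end_eq[OF u(2) m'(1)] t(1) u(1) by simp
    qed
  qed
qed

lemma square_vertices:
  assumes "s \<in> squares a b c"
  obtains (xy) x y z where "s = {(x, y, z), (x + 1, y, z), (x, y + 1, z), (x + 1, y + 1, z)}"
  | (xz) x y z where "s = {(x, y, z), (x + 1, y, z), (x, y, z + 1), (x + 1, y, z + 1)}"
  | (yz) x y z where "s = {(x, y, z), (x, y + 1, z), (x, y, z + 1), (x, y + 1, z + 1)}"
proof -
  consider x y z where "s = {x, x+1} \<times> {y, y+1} \<times> {z}" | x y z where "s = {x, x+1} \<times> {y} \<times> {z, z+1}"
    | x y z where "s = {x} \<times> {y, y+1} \<times> {z, z+1}"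
    using assms unfolding squares_def by blast
  then show ?thesis
    using that by cases (simp_all add: insert_Times_insert insert_commute)
qed

lemma even_vertex_neighbours:
  "even_vertex (x + 1, y, z) \<longleftrightarrow> \<not> even_vertex (x, y, z)"
  "even_vertex (x, y + 1, z) \<longleftrightarrow> \<not> even_vertex (x, y, z)"
  "even_vertex (x, y, z + 1) \<longleftrightarrow> \<not> even_vertex (x, y, z)"
  unfolding even_vertex_def by (simp, argo, simp, argo, simp)

lemma opposite_iff:
  assumes "s \<in> squares a b c" "v \<in> s" "w \<in> s"
  shows "opposite_vertices s v w \<longleftrightarrow> v \<noteq> w \<and> even_vertex v = even_vertex w"
proof -
  have "grid_dist v w = 2 \<longleftrightarrow> v \<noteq> w \<and> even_vertex v = even_vertex w"
    using assms(1)
    by (cases rule: square_vertices; use assms(2,3) in hypsubst; elim insertE emptyE; simp add: even_vertex_neighbours)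
  then show ?thesis using assms(2,3) by (simp add: opposite_vertices_def)
qed

lemma opposite_exists:
  assumes "s \<in> squares a b c" "v \<in> s"
  shows "\<exists>w. opposite_vertices s v w"
proof -
  have "\<exists>w \<in> s. grid_dist v w = 2"
    using assms(1)
    by (cases rule: square_vertices; use assms(2) in hypsubst; elim insertE emptyE; simp)
  then show ?thesis using assms(2) by (auto simp only: opposite_vertices_def)
qed

lemma opposite_unique:
  assumes "s \<in> squares a b c" "opposite_vertices s v w" "opposite_vertices s v w'"
  shows "w = w'"
proof -
  have mem: "v \<in> s" "w \<in> s" "w' \<in> s" and d: "grid_dist v w = 2" "grid_dist v w' = 2"
    using assms(2,3) by (simp_all only: opposite_vertices_def)
  have "grid_dist v w = 2 \<longrightarrow> grid_dist v w' = 2 \<longrightarrow> w = w'"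
    using assms(1)
    by (cases rule: square_vertices; use mem in hypsubst; elim insertE emptyE; simp)
  then show ?thesis using d by simp
qed

lemma vertex_of_parity_exists:
  assumes "s \<in> squares a b c"
  shows "\<exists>v \<in> s. even_vertex v = p"
proof -
  have "(\<exists>v \<in> s. even_vertex v) \<and> (\<exists>v \<in> s. \<not> even_vertex v)"
    using assms by (cases rule: square_vertices; hypsubst; simp add: even_vertex_neighbours)
  then show ?thesis by (cases p) simp_all
qed

lemma linked_sym: "linked a b c p s t \<Longrightarrow> linked a b c p t s"
  unfolding linked_def diag_adjacent_def Int_commute[of t s] by blast

lemma linked_rtranclp_sym: "(linked a b c p)\<^sup>*\<^sup>* s t \<Longrightarrow> (linked a b c p)\<^sup>*\<^sup>* t s"
proof (rule sympD[OF symp_rtranclp])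
  show "symp (linked a b c p)" by (rule sympI) (rule linked_sym)
qed

lemma diag_step_iff:
  "((s, v), (t, w)) \<in> diag_step a b c \<longleftrightarrow> diag_adjacent a b c v s t \<and> opposite_vertices t v w"
  unfolding diag_step_def by blast

lemma step_linked:
  assumes "((s, v), (t, w)) \<in> diag_step a b c"
  shows "linked a b c (even_vertex v) s t \<and> even_vertex w = even_vertex v"
proof -
  have *: "diag_adjacent a b c v s t" "opposite_vertices t v w" using assms unfolding diag_step_iff by blast+
  then have "t \<in> squares a b c" "v \<in> t" "w \<in> t" by (simp_all only: diag_adjacent_def opposite_vertices_def)
  then show ?thesis using * opposite_iff[of t a b c v w] unfolding linked_def by metis
qed

lemma steps_linked:
  assumes "((s, v), (t, w)) \<in> (diag_step a b c)\<^sup>*"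
  shows "(linked a b c (even_vertex v))\<^sup>*\<^sup>* s t \<and> even_vertex w = even_vertex v"
  using assms
proof (induction rule: rtrancl_induct2)
  case refl
  then show ?case by simp
next
  case (step q x t w)
  then have "linked a b c (even_vertex v) q t" "even_vertex w = even_vertex v"
    using step_linked[OF step(2)] by simp_all
  then show ?case using step.IH rtranclp.rtrancl_into_rtrancl[of "linked a b c (even_vertex v)" s q t] by blast
qed

lemma in_fst_Image2: "q \<in> fst ` (S `` {A, B}) \<longleftrightarrow> (\<exists>x. (A, (q, x)) \<in> S \<or> (B, (q, x)) \<in> S)"
proof
  assume "q \<in> fst ` (S `` {A, B})"
  then obtain y where "y \<in> S `` {A, B}" "q = fst y" by (rule imageE)
  then have "(A, (q, snd y)) \<in> S \<or> (B, (q, snd y)) \<in> S" by auto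
  then show "\<exists>x. (A, (q, x)) \<in> S \<or> (B, (q, x)) \<in> S" ..
next
  assume "\<exists>x. (A, (q, x)) \<in> S \<or> (B, (q, x)) \<in> S"
  then obtain x where "(q, x) \<in> S `` {A, B}" by blast
  then have "fst (q, x) \<in> fst ` (S `` {A, B})" by (rule imageI)
  then show "q \<in> fst ` (S `` {A, B})" by simp
qed

text \<open>
  A chain of linked squares may go back and forth, whereas the paths that make up a maximal diagonal never turn
  around. But the set of squares on these paths is closed under linking: from a square on a path, one vertex of
  the right parity leads to the next square, and the other one leads back to the previous square by the
  uniqueness of diagonal neighbours, or to the first square of the path that starts in the opposite direction.
\<close>

lemma common_diagonal_iff:
  assumes s: "s \<in> squares a b c"
  shows "(\<exists>D \<in> maximal_diagonals a b c. s \<in> D \<and> t \<in> D) \<longleftrightarrow> (\<exists>p. (linked a b c p)\<^sup>*\<^sup>* s t)"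
proof
  assume "\<exists>D \<in> maximal_diagonals a b c. s \<in> D \<and> t \<in> D"
  then obtain s0 v w where s0: "s0 \<in> squares a b c" and vw: "opposite_vertices s0 v w"
    and D: "s \<in> fst ` ((diag_step a b c)\<^sup>* `` {(s0, v), (s0, w)})" "t \<in> fst ` ((diag_step a b c)\<^sup>* `` {(s0, v), (s0, w)})"
    unfolding maximal_diagonals_def by blast
  have par: "even_vertex w = even_vertex v"
    using vw opposite_iff[OF s0] unfolding opposite_vertices_def by metis
  have "(linked a b c (even_vertex v))\<^sup>*\<^sup>* s0 x" if x: "x \<in> fst ` ((diag_step a b c)\<^sup>* `` {(s0, v), (s0, w)})" for x
  proof -
    obtain y where "((s0, v), (x, y)) \<in> (diag_step a b c)\<^sup>* \<or> ((s0, w), (x, y)) \<in> (diag_step a b c)\<^sup>*"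
      using x unfolding in_fst_Image2 by blast
    then show ?thesis
      using steps_linked[of s0 v x y a b c] steps_linked[of s0 w x y a b c] unfolding par by metis
  qed
  from this[OF D(1)] this[OF D(2)] have "(linked a b c (even_vertex v))\<^sup>*\<^sup>* s t"
    by (rule rtranclp_trans[OF linked_rtranclp_sym])
  then show "\<exists>p. (linked a b c p)\<^sup>*\<^sup>* s t"
    ..
next
  assume "\<exists>p. (linked a b c p)\<^sup>*\<^sup>* s t"
  then obtain p where p: "(linked a b c p)\<^sup>*\<^sup>* s t" by blast
  obtain v where v: "v \<in> s" "even_vertex v = p" using vertex_of_parity_exists[OF s] by blast
  obtain w where w: "opposite_vertices s v w" using opposite_exists[OF s v(1)] by blast
  have w': "w \<in> s" "even_vertex w = p" using w v opposite_iff[OF s] unfolding opposite_vertices_def by metis+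
  define R where "R = (diag_step a b c)\<^sup>* `` {(s, v), (s, w)}"
  have R_state: "even_vertex x = p \<and> q \<in> squares a b c \<and> x \<in> q
      \<and> (q = s \<or> (\<exists>q' y. (q', y) \<in> R \<and> diag_adjacent a b c y q' q \<and> opposite_vertices q y x))"
    if qx: "(q, x) \<in> R" for q x
  proof -
    obtain i where i: "i = v \<or> i = w" and st: "((s, i), (q, x)) \<in> (diag_step a b c)\<^sup>*"
      using qx unfolding R_def by blast
    have par: "even_vertex x = p" using steps_linked[OF st] i v w' by auto
    show ?thesis using st
    proof (cases rule: rtranclE)
      case base
      then show ?thesis using i v w' s par by blast
    next
      case (step y)
      then obtain q' z where y: "y = (q', z)" and d: "((q', z), (q, x)) \<in> diag_step a b c" by (cases y) auto
      have "(q', z) \<in> R" using step y i unfolding R_def by blast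
      moreover have "diag_adjacent a b c z q' q" "opposite_vertices q z x" using d unfolding diag_step_iff by blast+
      moreover have "q \<in> squares a b c" "x \<in> q"
        using calculation(2,3) by (simp_all only: diag_adjacent_def opposite_vertices_def)
      ultimately show ?thesis using par by metis
    qed
  qed
  have "\<exists>x. (t, x) \<in> R" using p
  proof induction
    case base
    then show ?case unfolding R_def by blast
  next
    case (step q q')
    then obtain x y where x: "(q, x) \<in> R" and y: "diag_adjacent a b c y q q'" "even_vertex y = p"
      unfolding linked_def by blast
    have fwd: "\<exists>x. (q', x) \<in> R" if "(q, y) \<in> R"
    proof -
      obtain z where "opposite_vertices q' y z"
        using opposite_exists[of q' a b c y] y(1) unfolding diag_adjacent_def by blast
      then have "((q, y), (q', z)) \<in> diag_step a b c" using y unfolding diag_step_iff by blast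
      then have "(q', z) \<in> R" using that unfolding R_def by (meson Image_iff rtrancl_into_rtrancl)
      then show ?thesis ..
    qed
    have yq: "y \<in> q" "q \<in> squares a b c" using y unfolding diag_adjacent_def by blast+
    \<comment> \<open>Either the path has just started, or the square was entered through a known vertex.\<close>
    consider "q = s" | q0 y0 where "(q0, y0) \<in> R" "diag_adjacent a b c y0 q0 q" "opposite_vertices q y0 x"
      using R_state[OF x] by blast
    then show ?case
    proof cases
      case 1
      then have "y = v \<or> y = w"
        using yq v(1) v(2) y(2) opposite_iff[OF s] opposite_unique[OF s w] by metis
      then show ?thesis using fwd 1 unfolding R_def by blast
    next
      case 2
      show ?thesis
      proof (cases "y = x")
        case True
        then show ?thesis using fwd x by simp
      next
        case False
        then have "opposite_vertices q x y"
          using opposite_iff[OF yq(2)] R_state[OF x] yq(1) y(2) by metis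
        moreover have "opposite_vertices q x y0"
          using 2(3) opposite_iff[OF yq(2)] unfolding opposite_vertices_def by metis
        ultimately have "y0 = y" using opposite_unique[OF yq(2)] by blast
        moreover have "diag_adjacent a b c y0 q q0" using 2(2) unfolding diag_adjacent_def by blast
        ultimately have "q' = q0" using diagonal_neighbour_unique y(1) by blast
        then show ?thesis using 2(1) by blast
      qed
    qed
  qed
  then have "t \<in> fst ` R" "s \<in> fst ` R" unfolding R_def in_fst_Image2 by blast+
  moreover have "fst ` R \<in> maximal_diagonals a b c" using s w unfolding maximal_diagonals_def R_def by blast
  ultimately show "\<exists>D \<in> maximal_diagonals a b c. s \<in> D \<and> t \<in> D" by blast
qed

datatype coord = Tube int int | Cap int int int

text \<open>
  \<open>Entry d\<close> is a diagonal that comes down to the bottom at the position \<open>d\<close>,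
  \<open>Rise c\<close> one that climbs from a corner of the bottom straight to a corner of the top, and
  \<open>Medial h i\<close> a main diagonal of the end face at height \<open>h\<close>, along
  \<open>x = y\<close> for \<open>i = 0\<close> and along \<open>x + y = n\<close> for \<open>i = 1\<close>.
\<close>

datatype diagonal_label = Entry int | Rise int | Medial int int

section \<open>Coordinates on the surface\<close>

lemma squaresI:
  "0 \<le> x \<Longrightarrow> x < a \<Longrightarrow> 0 \<le> y \<Longrightarrow> y < b \<Longrightarrow> z = 0 \<or> z = c \<Longrightarrow> {x, x+1} \<times> {y, y+1} \<times> {z} \<in> squares a b c"
  "0 \<le> x \<Longrightarrow> x < a \<Longrightarrow> y = 0 \<or> y = b \<Longrightarrow> 0 \<le> z \<Longrightarrow> z < c \<Longrightarrow> {x, x+1} \<times> {y} \<times> {z, z+1} \<in> squares a b c"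
  "x = 0 \<or> x = a \<Longrightarrow> 0 \<le> y \<Longrightarrow> y < b \<Longrightarrow> 0 \<le> z \<Longrightarrow> z < c \<Longrightarrow> {x} \<times> {y, y+1} \<times> {z, z+1} \<in> squares a b c"
  unfolding squares_def Un_iff mem_Collect_eq atLeastLessThan_iff insert_iff by blast+

locale prism =
  fixes n k r :: int
  assumes n_pos: "1 \<le> n" and r_ge: "0 \<le> r" and r_less: "r < n" and tall: "n \<le> k * n + r"
begin

definition m where "m = k * n + r"

lemma m_ge: "n \<le> m" and m_pos: "0 < m"
  using tall n_pos by (simp_all add: m_def)

text \<open>
  The side faces are unrolled: \<open>perimeter u\<close> runs counterclockwise around the square
  \<open>[0,n] \<times> [0,n]\<close> as \<open>u\<close> increases, starting at the origin, with a corner at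
  every multiple of \<open>n\<close>.
\<close>

definition perimeter :: "int \<Rightarrow> int \<times> int" where
  "perimeter u = (let v = u mod (4 * n) in
     if v \<le> n then (v, 0) else if v \<le> 2 * n then (n, v - n)
     else if v \<le> 3 * n then (3 * n - v, n) else (0, 4 * n - v))"

text \<open>
  The unit square of an end face that has the perimeter edge from \<open>u\<close> to \<open>u + 1\<close> as a
  side.
\<close>

definition rim :: "int \<Rightarrow> int \<times> int" where
  "rim u = (let v = u mod (4 * n) in
     if v < n then (v, 0) else if v < 2 * n then (n - 1, v - n)
     else if v < 3 * n then (3 * n - 1 - v, n - 1) else (0, 4 * n - 1 - v))"

definition tube_vertex :: "int \<Rightarrow> int \<Rightarrow> vertex" where
  "tube_vertex u z = (fst (perimeter u), snd (perimeter u), z)"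

text \<open>
  \<open>Tube u z\<close> is the square of a side face with left end \<open>u\<close> at the height between
  \<open>z\<close> and \<open>z + 1\<close>; the coordinate \<open>u\<close> is only determined modulo
  \<open>4n\<close>. \<open>Cap h x y\<close> lies on the end face at height \<open>h\<close>.
\<close>

fun square_of :: "coord \<Rightarrow> square" where
  "square_of (Tube u z) = {tube_vertex u z, tube_vertex (u + 1) z, tube_vertex u (z + 1), tube_vertex (u + 1) (z + 1)}"
| "square_of (Cap h x y) = {(x, y, h), (x + 1, y, h), (x, y + 1, h), (x + 1, y + 1, h)}"

fun valid :: "coord \<Rightarrow> bool" where
  "valid (Tube u z) \<longleftrightarrow> 0 \<le> z \<and> z < m"
| "valid (Cap h x y) \<longleftrightarrow> (h = 0 \<or> h = m) \<and> 0 \<le> x \<and> x < n \<and> 0 \<le> y \<and> y < n"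

lemma perimeter_mod: "u mod (4 * n) = u' mod (4 * n) \<Longrightarrow> perimeter u = perimeter u'"
  by (simp add: perimeter_def)

lemma rim_mod: "u mod (4 * n) = u' mod (4 * n) \<Longrightarrow> rim u = rim u'"
  by (simp add: rim_def)

lemma perimeter_inj:
  assumes "perimeter u = perimeter u'" shows "u mod (4 * n) = u' mod (4 * n)"
proof -
  define v v' where v: "v = u mod (4 * n)" "v' = u' mod (4 * n)"
  have "0 \<le> v" "v < 4 * n" "0 \<le> v'" "v' < 4 * n"
    using n_pos by (simp_all add: v)
  moreover have "(if v \<le> n then (v, 0) else if v \<le> 2 * n then (n, v - n)
     else if v \<le> 3 * n then (3 * n - v, n) else (0, 4 * n - v)) =
     (if v' \<le> n then (v', 0) else if v' \<le> 2 * n then (n, v' - n)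
     else if v' \<le> 3 * n then (3 * n - v', n) else (0, 4 * n - v'))"
    using assms unfolding perimeter_def Let_def v .
  ultimately have "v = v'" by (simp split: if_splits)
  then show ?thesis by (simp add: v)
qed

lemma perimeter_eq_iff: "perimeter u = perimeter u' \<longleftrightarrow> 4 * n dvd u - u'"
  using perimeter_inj perimeter_mod by (metis mod_eq_dvd_iff)

lemma tube_vertex_eq_iff: "tube_vertex u z = tube_vertex u' z' \<longleftrightarrow> 4 * n dvd u - u' \<and> z = z'"
  unfolding tube_vertex_def perimeter_eq_iff[symmetric] by (auto simp: prod_eq_iff)

lemma even_mod_4n: "even (u mod (4 * n)) \<longleftrightarrow> even u"
  by (simp add: dvd_mod_iff)

lemma even_tube_vertex: "even_vertex (tube_vertex u z) \<longleftrightarrow> even (u + z)"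
proof -
  define v where "v = u mod (4 * n)"
  have "even (fst (perimeter u) + snd (perimeter u)) \<longleftrightarrow> even v"
    unfolding perimeter_def Let_def v_def[symmetric] by (simp; argo)
  then show ?thesis by (simp add: tube_vertex_def even_vertex_def v_def even_mod_4n)
qed

lemma corner_multiples:
  assumes "n dvd v" "0 \<le> v" "v < 4 * n"
  shows "v = 0 \<or> v = n \<or> v = 2 * n \<or> v = 3 * n"
proof -
  obtain i where i: "v = n * i" using assms(1) ..
  then have "0 \<le> i" "i < 4" using assms n_pos
    by (simp_all add: zero_le_mult_iff mult.commute[of n])
  then have "i = 0 \<or> i = 1 \<or> i = 2 \<or> i = 3" by linarith
  then show ?thesis using i by auto
qed

lemma tube_vertex_corner: "tube_vertex u z \<in> corners n n m \<longleftrightarrow> n dvd u \<and> (z = 0 \<or> z = m)"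
proof -
  define v where "v = u mod (4 * n)"
  have v: "0 \<le> v" "v < 4 * n" using n_pos by (simp_all add: v_def)
  have dvd: "n dvd u \<longleftrightarrow> n dvd v" unfolding v_def by (simp add: dvd_mod_iff)
  have "n dvd v \<longleftrightarrow> v = 0 \<or> v = n \<or> v = 2 * n \<or> v = 3 * n"
    using corner_multiples v by auto
  moreover have "fst (perimeter u) \<in> {0, n} \<and> snd (perimeter u) \<in> {0, n} \<longleftrightarrow> v = 0 \<or> v = n \<or> v = 2 * n \<or> v = 3 * n"
    unfolding perimeter_def Let_def v_def[symmetric] using v n_pos by auto
  ultimately show ?thesis using dvd by (auto simp: tube_vertex_def corners_def)
qed

lemma square_of_Tube_mod: "u mod (4 * n) = u' mod (4 * n) \<Longrightarrow> square_of (Tube u z) = square_of (Tube u' z)"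
proof -
  assume u: "u mod (4 * n) = u' mod (4 * n)"
  then have "(u + 1) mod (4 * n) = (u' + 1) mod (4 * n)" by (rule mod_add_cong) simp
  then have "perimeter (u + 1) = perimeter (u' + 1)" "perimeter u = perimeter u'" using u perimeter_mod by blast+
  then show ?thesis by (simp add: tube_vertex_def)
qed

lemma not_dvd_small: "i \<noteq> 0 \<Longrightarrow> \<bar>i\<bar> < 4 * n \<Longrightarrow> \<not> 4 * n dvd (i::int)"
  using n_pos by (auto dest: dvd_imp_le_int)

lemma perimeter_faces:
  "0 \<le> v \<Longrightarrow> v \<le> n \<Longrightarrow> perimeter v = (v, 0)"
  "n \<le> v \<Longrightarrow> v \<le> 2 * n \<Longrightarrow> perimeter v = (n, v - n)"
  "2 * n \<le> v \<Longrightarrow> v \<le> 3 * n \<Longrightarrow> perimeter v = (3 * n - v, n)"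
  "3 * n \<le> v \<Longrightarrow> v \<le> 4 * n \<Longrightarrow> perimeter v = (0, 4 * n - v)"
proof -
  show "3 * n \<le> v \<Longrightarrow> v \<le> 4 * n \<Longrightarrow> perimeter v = (0, 4 * n - v)"
    using n_pos by (cases "v = 4 * n") (auto simp: perimeter_def)
qed (use n_pos in \<open>simp_all add: perimeter_def\<close>)

lemma rim_faces:
  "0 \<le> v \<Longrightarrow> v < n \<Longrightarrow> rim v = (v, 0)"
  "n \<le> v \<Longrightarrow> v < 2 * n \<Longrightarrow> rim v = (n - 1, v - n)"
  "2 * n \<le> v \<Longrightarrow> v < 3 * n \<Longrightarrow> rim v = (3 * n - 1 - v, n - 1)"
  "3 * n \<le> v \<Longrightarrow> v < 4 * n \<Longrightarrow> rim v = (0, 4 * n - 1 - v)"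
  using n_pos by (simp_all add: rim_def)

lemma face_cases:
  assumes "0 \<le> v" "v < 4 * n"
  obtains "0 \<le> v" "v < n" | "n \<le> v" "v < 2 * n" | "2 * n \<le> v" "v < 3 * n" | "3 * n \<le> v" "v < 4 * n"
  using assms by linarith

lemma square_of_Tube_faces:
  "0 \<le> v \<Longrightarrow> v < n \<Longrightarrow> square_of (Tube v z) = {v, v+1} \<times> {0} \<times> {z, z+1}"
  "n \<le> v \<Longrightarrow> v < 2 * n \<Longrightarrow> square_of (Tube v z) = {n} \<times> {v - n, v - n + 1} \<times> {z, z+1}"
  "2 * n \<le> v \<Longrightarrow> v < 3 * n \<Longrightarrow> square_of (Tube v z) = {3 * n - 1 - v, 3 * n - 1 - v + 1} \<times> {n} \<times> {z, z+1}"
  "3 * n \<le> v \<Longrightarrow> v < 4 * n \<Longrightarrow> square_of (Tube v z) = {0} \<times> {4 * n - 1 - v, 4 * n - 1 - v + 1} \<times> {z, z+1}"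
proof -
  show "0 \<le> v \<Longrightarrow> v < n \<Longrightarrow> square_of (Tube v z) = {v, v+1} \<times> {0} \<times> {z, z+1}"
    using perimeter_faces(1)[of v] perimeter_faces(1)[of "v + 1"]
    by (simp add: tube_vertex_def insert_Times_insert insert_commute)
  show "n \<le> v \<Longrightarrow> v < 2 * n \<Longrightarrow> square_of (Tube v z) = {n} \<times> {v - n, v - n + 1} \<times> {z, z+1}"
    using perimeter_faces(2)[of v] perimeter_faces(2)[of "v + 1"]
    by (simp add: tube_vertex_def insert_Times_insert) (auto simp: algebra_simps)
  show "2 * n \<le> v \<Longrightarrow> v < 3 * n \<Longrightarrow> square_of (Tube v z) = {3 * n - 1 - v, 3 * n - 1 - v + 1} \<times> {n} \<times> {z, z+1}"
    using perimeter_faces(3)[of v] perimeter_faces(3)[of "v + 1"]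
    by (simp add: tube_vertex_def insert_Times_insert) (auto simp: algebra_simps)
  show "3 * n \<le> v \<Longrightarrow> v < 4 * n \<Longrightarrow> square_of (Tube v z) = {0} \<times> {4 * n - 1 - v, 4 * n - 1 - v + 1} \<times> {z, z+1}"
    using perimeter_faces(4)[of v] perimeter_faces(4)[of "v + 1"]
    by (simp add: tube_vertex_def insert_Times_insert) (auto simp: algebra_simps)
qed

lemma square_of_Cap: "square_of (Cap h x y) = {x, x+1} \<times> {y, y+1} \<times> {h}"
  by (auto simp: insert_Times_insert)

lemma in_squares_iff: "s \<in> squares n n m \<longleftrightarrow> (\<exists>a. valid a \<and> square_of a = s)"
proof
  assume "s \<in> squares n n m"
  then consider x y z where "s = {x, x+1} \<times> {y, y+1} \<times> {z}" "0 \<le> x" "x < n" "0 \<le> y" "y < n" "z = 0 \<or> z = m"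
    | x y z where "s = {x, x+1} \<times> {y} \<times> {z, z+1}" "0 \<le> x" "x < n" "0 \<le> z" "z < m" "y = 0 \<or> y = n"
    | x y z where "s = {x} \<times> {y, y+1} \<times> {z, z+1}" "0 \<le> y" "y < n" "0 \<le> z" "z < m" "x = 0 \<or> x = n"
    unfolding squares_def Un_iff mem_Collect_eq atLeastLessThan_iff insert_iff empty_iff by blast
  then show "\<exists>a. valid a \<and> square_of a = s"
  proof cases
    case (1 x y z)
    then have "valid (Cap z x y)" "square_of (Cap z x y) = s" unfolding square_of_Cap by simp_all
    then show ?thesis by blast
  next
    case (2 x y z)
    show ?thesis
    proof (cases "y = 0")
      case True
      then have "valid (Tube x z)" "square_of (Tube x z) = s" using 2 square_of_Tube_faces(1)[of x z] by simp_all
      then show ?thesis by blast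
    next
      case False
      then have "valid (Tube (3 * n - 1 - x) z)" "square_of (Tube (3 * n - 1 - x) z) = s"
        using 2 square_of_Tube_faces(3)[of "3 * n - 1 - x" z] by simp_all
      then show ?thesis by blast
    qed
  next
    case (3 x y z)
    show ?thesis
    proof (cases "x = 0")
      case True
      then have "valid (Tube (4 * n - 1 - y) z)" "square_of (Tube (4 * n - 1 - y) z) = s"
        using 3 square_of_Tube_faces(4)[of "4 * n - 1 - y" z] by simp_all
      then show ?thesis by blast
    next
      case False
      then have "valid (Tube (n + y) z)" "square_of (Tube (n + y) z) = s"
        using 3 square_of_Tube_faces(2)[of "n + y" z] by simp_all
      then show ?thesis by blast
    qed
  qed
next
  assume "\<exists>a. valid a \<and> square_of a = s"
  then obtain a where a: "valid a" "square_of a = s" by blast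
  show "s \<in> squares n n m"
  proof (cases a)
    case (Tube u z)
    define v where "v = u mod (4 * n)"
    have v: "0 \<le> v" "v < 4 * n" using n_pos by (simp_all add: v_def)
    have s: "s = square_of (Tube v z)" using a Tube square_of_Tube_mod[of u v z] by (simp add: v_def)
    have z: "0 \<le> z" "z < m" using a Tube by simp_all
    from v show ?thesis
    proof (cases rule: face_cases)
      case 1
      then show ?thesis unfolding s square_of_Tube_faces(1)[OF 1] using z by (intro squaresI) simp_all
    next
      case 2
      then show ?thesis unfolding s square_of_Tube_faces(2)[OF 2] using z by (intro squaresI) simp_all
    next
      case 3
      then show ?thesis unfolding s square_of_Tube_faces(3)[OF 3] using z by (intro squaresI) simp_all
    next
      case 4
      then show ?thesis unfolding s square_of_Tube_faces(4)[OF 4] using z by (intro squaresI) simp_all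
    qed
  next
    case (Cap h x y)
    then show ?thesis using a(1) unfolding a(2)[symmetric] Cap square_of_Cap by (intro squaresI) simp_all
  qed
qed

section \<open>Diagonal neighbours in coordinates\<close>

definition adj :: "vertex \<Rightarrow> coord \<Rightarrow> coord \<Rightarrow> bool" where
  "adj v a b \<longleftrightarrow> valid a \<and> valid b \<and> v \<notin> corners n n m \<and> square_of a \<inter> square_of b = {v}"

lemma adj_sym: "adj v a b \<Longrightarrow> adj v b a"
  unfolding adj_def by (simp add: Int_commute)

lemma adj_iff: "adj v a b \<longleftrightarrow> valid a \<and> valid b \<and> diag_adjacent n n m v (square_of a) (square_of b)"
  unfolding adj_def diag_adjacent_def using in_squares_iff by blast

lemma adj_up:
  assumes "0 \<le> z" "z + 1 < m"
  shows "adj (tube_vertex (u + 1) (z + 1)) (Tube u z) (Tube (u + 1) (z + 1))"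
proof -
  have "\<not> 4 * n dvd 1" "\<not> 4 * n dvd 2" using n_pos by (simp_all add: not_dvd_small)
  then show ?thesis using assms by (auto simp: adj_def tube_vertex_corner tube_vertex_eq_iff)
qed

lemma adj_down:
  assumes "0 \<le> z" "z + 1 < m"
  shows "adj (tube_vertex u (z + 1)) (Tube u z) (Tube (u - 1) (z + 1))"
proof -
  have "\<not> 4 * n dvd 1" "\<not> 4 * n dvd 2" using n_pos by (simp_all add: not_dvd_small)
  then show ?thesis using assms by (auto simp: adj_def tube_vertex_corner tube_vertex_eq_iff)
qed

lemma adj_cap_up:
  assumes "valid (Cap h x y)" "x + 1 < n" "y + 1 < n"
  shows "adj (x + 1, y + 1, h) (Cap h x y) (Cap h (x + 1) (y + 1))"
  using assms by (auto simp: adj_def corners_def)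

lemma adj_cap_down:
  assumes "valid (Cap h x y)" "0 < x" "y + 1 < n"
  shows "adj (x, y + 1, h) (Cap h x y) (Cap h (x - 1) (y + 1))"
  using assms by (auto simp: adj_def corners_def)

definition rim_cap :: "int \<Rightarrow> int \<Rightarrow> coord" where
  "rim_cap h u = Cap h (fst (rim u)) (snd (rim u))"

lemma rim_cap_mod: "u mod (4 * n) = u' mod (4 * n) \<Longrightarrow> rim_cap h u = rim_cap h u'"
  by (simp add: rim_cap_def rim_mod[of u u'])

lemma valid_rim: "h = 0 \<or> h = m \<Longrightarrow> valid (rim_cap h u)"
proof -
  define v where "v = u mod (4 * n)"
  have v: "0 \<le> v" "v < 4 * n" using n_pos by (simp_all add: v_def)
  have eq: "rim_cap h u = rim_cap h v" by (rule rim_cap_mod) (simp add: v_def)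
  assume "h = 0 \<or> h = m"
  with v show ?thesis unfolding eq unfolding rim_cap_def
    by (cases rule: face_cases) (simp_all add: rim_faces)
qed

text \<open>
  Statements about a position \<open>d\<close> and its predecessor may be checked on one turn of the perimeter.
\<close>

lemma reduce_mod:
  fixes d :: int
  obtains v where "0 \<le> v" "v < 4 * n" "d mod (4 * n) = v mod (4 * n)" "(d - 1) mod (4 * n) = (v - 1) mod (4 * n)"
    "n dvd d \<longleftrightarrow> n dvd v" "even d \<longleftrightarrow> even v"
proof
  define v where "v = d mod (4 * n)"
  show "0 \<le> v" "v < 4 * n" using n_pos by (simp_all add: v_def)
  show "d mod (4 * n) = v mod (4 * n)" by (simp add: v_def)
  show "(d - 1) mod (4 * n) = (v - 1) mod (4 * n)" by (simp add: v_def mod_diff_left_eq)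
  show "n dvd d \<longleftrightarrow> n dvd v" by (simp add: v_def dvd_mod_iff)
  show "even d \<longleftrightarrow> even v" by (simp add: v_def even_mod_4n)
qed

lemma inner_face_cases:
  assumes "0 \<le> v" "v < 4 * n" "\<not> n dvd v"
  obtains "0 < v" "v < n" | "n < v" "v < 2 * n" | "2 * n < v" "v < 3 * n" | "3 * n < v" "v < 4 * n"
proof -
  have "v \<noteq> 0" "v \<noteq> n" "v \<noteq> 2 * n" "v \<noteq> 3 * n" using assms(3) by auto
  then show ?thesis using assms that by linarith
qed

text \<open>
  The crossing of a horizontal edge of the box at its vertex \<open>d\<close>. Of the two squares on either side
  of the edge, the one before \<open>d\<close> is opposite to the one after \<open>d\<close>.
\<close>

lemma adj_rim:
  assumes "\<not> n dvd d" and zh: "z = 0 \<and> h = 0 \<or> z = m - 1 \<and> h = m"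
  shows "adj (tube_vertex d h) (Tube (d - 1) z) (rim_cap h d)"
    and "adj (tube_vertex d h) (Tube d z) (rim_cap h (d - 1))"
proof -
  obtain v where v: "0 \<le> v" "v < 4 * n" "d mod (4 * n) = v mod (4 * n)"
    "(d - 1) mod (4 * n) = (v - 1) mod (4 * n)" "n dvd d \<longleftrightarrow> n dvd v"
    using reduce_mod .
  have eqs: "square_of (Tube (d - 1) z) = square_of (Tube (v - 1) z)" "square_of (Tube d z) = square_of (Tube v z)"
    "rim_cap h d = rim_cap h v" "rim_cap h (d - 1) = rim_cap h (v - 1)"
    using v square_of_Tube_mod rim_cap_mod by blast+
  have tube_vertex: "tube_vertex d h = tube_vertex v h" using perimeter_mod[OF v(3)] by (simp add: tube_vertex_def)
  have h: "h = z \<or> h = z + 1" "h = 0 \<or> h = m" "0 \<le> z" "z < m" using zh m_pos by auto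
  have inner: "\<not> n dvd v" using assms v by simp
  have "square_of (Tube (v - 1) z) \<inter> square_of (rim_cap h v) = {tube_vertex v h} \<and> square_of (Tube v z) \<inter> square_of (rim_cap h (v - 1)) = {tube_vertex v h}"
    using v(1,2) inner
  proof (cases rule: inner_face_cases)
    case 1
    then have p: "perimeter v = (v, 0)" "rim v = (v, 0)" "rim (v - 1) = (v - 1, 0)"
      "square_of (Tube (v - 1) z) = {v - 1, v} \<times> {0} \<times> {z, z+1}" "square_of (Tube v z) = {v, v + 1} \<times> {0} \<times> {z, z+1}"
      using perimeter_faces(1)[of v] rim_faces(1)[of v] rim_faces(1)[of "v - 1"]
        square_of_Tube_faces(1)[of "v - 1" z] square_of_Tube_faces(1)[of v z] by simp_all
    show ?thesis unfolding rim_cap_def square_of_Cap p tube_vertex_def using h by auto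
  next
    case 2
    then have p: "perimeter v = (n, v - n)" "rim v = (n - 1, v - n)" "rim (v - 1) = (n - 1, v - 1 - n)"
      "square_of (Tube (v - 1) z) = {n} \<times> {v - 1 - n, v - n} \<times> {z, z+1}" "square_of (Tube v z) = {n} \<times> {v - n, v - n + 1} \<times> {z, z+1}"
      using perimeter_faces(2)[of v] rim_faces(2)[of v] rim_faces(2)[of "v - 1"]
        square_of_Tube_faces(2)[of "v - 1" z] square_of_Tube_faces(2)[of v z] by simp_all
    show ?thesis unfolding rim_cap_def square_of_Cap p tube_vertex_def using h by auto
  next
    case 3
    then have p: "perimeter v = (3 * n - v, n)" "rim v = (3 * n - 1 - v, n - 1)" "rim (v - 1) = (3 * n - v, n - 1)"
      "square_of (Tube (v - 1) z) = {3 * n - v, 3 * n - v + 1} \<times> {n} \<times> {z, z+1}"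
      "square_of (Tube v z) = {3 * n - 1 - v, 3 * n - v} \<times> {n} \<times> {z, z+1}"
      using perimeter_faces(3)[of v] rim_faces(3)[of v] rim_faces(3)[of "v - 1"]
        square_of_Tube_faces(3)[of "v - 1" z] square_of_Tube_faces(3)[of v z] by simp_all
    show ?thesis unfolding rim_cap_def square_of_Cap p tube_vertex_def using h by auto
  next
    case 4
    then have p: "perimeter v = (0, 4 * n - v)" "rim v = (0, 4 * n - 1 - v)" "rim (v - 1) = (0, 4 * n - v)"
      "square_of (Tube (v - 1) z) = {0} \<times> {4 * n - v, 4 * n - v + 1} \<times> {z, z+1}"
      "square_of (Tube v z) = {0} \<times> {4 * n - 1 - v, 4 * n - v} \<times> {z, z+1}"
      using perimeter_faces(4)[of v] rim_faces(4)[of v] rim_faces(4)[of "v - 1"]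
        square_of_Tube_faces(4)[of "v - 1" z] square_of_Tube_faces(4)[of v z] by simp_all
    show ?thesis unfolding rim_cap_def square_of_Cap p tube_vertex_def using h by auto
  qed
  moreover have "tube_vertex v h \<notin> corners n n m" using inner tube_vertex_corner by simp
  ultimately show "adj (tube_vertex d h) (Tube (d - 1) z) (rim_cap h d)"
    and "adj (tube_vertex d h) (Tube d z) (rim_cap h (d - 1))"
    unfolding adj_def eqs tube_vertex using valid_rim h by simp_all
qed

section \<open>Names for the diagonals\<close>

text \<open>
  Whether the four entries with residue \<open>a\<close> modulo \<open>n\<close>, one for each side face, belong
  to four different diagonals. Otherwise entries on opposite faces belong to the same diagonal.
\<close>

definition separate :: "int \<Rightarrow> bool" where
  "separate a \<longleftrightarrow> a = 0 \<or> a = r \<or> (if even k then a < r else r < a)"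

text \<open>
  The diagonal that comes down to the bottom at position \<open>d\<close>. Positions half a turn apart are
  identified unless their residue is separate.
\<close>

definition entry :: "int \<Rightarrow> diagonal_label" where
  "entry d = Entry (if separate (d mod n) then d mod (4 * n) else d mod (2 * n))"

text \<open>
  The diagonal that climbs from the bottom at position \<open>c\<close>, named after the entry at which it came
  down. If \<open>c\<close> is not a corner, the last entry is the mirror image of \<open>c\<close> in the
  previous corner. If \<open>c\<close> is a corner, the diagonal starts there, and its next entry is used
  instead. For \<open>r = 0\<close> there is none, since it climbs to a corner of the top.
\<close>

definition rise :: "int \<Rightarrow> diagonal_label" where
  "rise c = (if n dvd c then if r = 0 then Rise (c mod (4 * n)) else entry (c + 2 * n * (k + 1))
     else entry (2 * n * (c div n) - c))"

text \<open>
  The diagonal on an end face along the line \<open>x - y = i\<close>. On the bottom it is named after the side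
  face from which it enters, going around a corner in the positive direction. On the top, the position at which
  it leaves is translated by \<open>m\<close> to its next entry.
\<close>

definition up_label :: "int \<Rightarrow> int \<Rightarrow> diagonal_label" where
  "up_label h i = (if i = 0 then Medial h 0
     else if h = 0 then entry (if 0 < i then i else 2 * n - i)
     else entry (m + (if 0 < i then 2 * n - i else i)))"

text \<open>
  The same for the line \<open>x + y = i\<close>.
\<close>

definition down_label :: "int \<Rightarrow> int \<Rightarrow> diagonal_label" where
  "down_label h i = (if i = n then Medial h 1
     else if h = 0 then entry (if n < i then i else 4 * n - i)
     else entry (m + (if n < i then 4 * n - i else i)))"

text \<open>
  A diagonal of parity \<open>p\<close> passes through the lower left vertex of a square or else through the
  lower right one, depending on the parity of the lower left vertex.
\<close>

fun label :: "bool \<Rightarrow> coord \<Rightarrow> diagonal_label" where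
  "label p (Tube u z) = (if even (u + z) = p then rise (u - z) else entry (u + z + 1))"
| "label p (Cap h x y) = (if even (x + y + h) = p then up_label h (x - y) else down_label h (x + y + 1))"

lemma entry_4n: "entry (d + 4 * n * i) = entry d"
proof -
  have "(d + n * (4 * i)) mod n = d mod n" "(d + (2 * n) * (2 * i)) mod (2 * n) = d mod (2 * n)"
    by (rule mod_mult_self2)+
  then have "(d + 4 * n * i) mod n = d mod n" "(d + 4 * n * i) mod (2 * n) = d mod (2 * n)"
    by (simp_all add: algebra_simps)
  moreover have "(d + 4 * n * i) mod (4 * n) = d mod (4 * n)" by (rule mod_mult_self2)
  ultimately show ?thesis unfolding entry_def by simp
qed

lemma entry_2n:
  assumes "\<not> separate (d mod n)"
  shows "entry (d + 2 * n * i) = entry d"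
proof -
  have "(d + n * (2 * i)) mod n = d mod n" by (rule mod_mult_self2)
  then have "(d + 2 * n * i) mod n = d mod n" by (simp add: algebra_simps)
  moreover have "(d + 2 * n * i) mod (2 * n) = d mod (2 * n)" by (rule mod_mult_self2)
  ultimately show ?thesis using assms unfolding entry_def by simp
qed

lemma entry_shift:
  assumes "d' = d + 2 * n * i" "even i \<or> \<not> separate (d mod n)"
  shows "entry d' = entry d"
proof (cases "even i")
  case True
  then obtain j where "i = 2 * j" by blast
  then show ?thesis using assms entry_4n[of d j] by (simp add: algebra_simps)
next
  case False
  then show ?thesis using assms entry_2n by simp
qed

lemma entry_mod: "d mod (4 * n) = d' mod (4 * n) \<Longrightarrow> entry d = entry d'"
  by (metis entry_4n mult_div_mod_eq add.commute)

lemma rise_4n: "rise (c + 4 * n * i) = rise c"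
proof -
  have dvd: "n dvd c + 4 * n * i \<longleftrightarrow> n dvd c" by (simp add: dvd_add_left_iff)
  have "(c + n * (4 * i)) div n = c div n + 4 * i" using n_pos by simp
  then have "(c + 4 * n * i) div n = c div n + 4 * i" by (simp add: algebra_simps)
  then have "2 * n * ((c + 4 * n * i) div n) - (c + 4 * n * i) = 2 * n * (c div n) - c + 4 * n * i"
    by (simp add: algebra_simps)
  then have *: "entry (2 * n * ((c + 4 * n * i) div n) - (c + 4 * n * i)) = entry (2 * n * (c div n) - c)"
    using entry_4n[of "2 * n * (c div n) - c" i] by (simp only:)
  have "c + 4 * n * i + 2 * n * (k + 1) = c + 2 * n * (k + 1) + 4 * n * i" by simp
  then have **: "entry (c + 4 * n * i + 2 * n * (k + 1)) = entry (c + 2 * n * (k + 1))"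
    using entry_4n[of "c + 2 * n * (k + 1)" i] by (simp only:)
  have "(c + 4 * n * i) mod (4 * n) = c mod (4 * n)" by simp
  then show ?thesis unfolding rise_def dvd * ** by (simp only:)
qed

lemma rise_mod: "c mod (4 * n) = c' mod (4 * n) \<Longrightarrow> rise c = rise c'"
  by (metis rise_4n mult_div_mod_eq add.commute)

lemma block:
  fixes d :: int
  obtains j a where "d = j * n + a" "0 \<le> a" "a < n" "d div n = j" "d mod n = a" "n dvd d \<longleftrightarrow> a = 0"
proof
  show "d = (d div n) * n + d mod n" by simp
  show "0 \<le> d mod n" "d mod n < n" using n_pos by simp_all
  show "d div n = d div n" "d mod n = d mod n" by simp_all
  show "n dvd d \<longleftrightarrow> d mod n = 0" by (rule dvd_eq_mod_eq_0)
qed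

lemma block_unique:
  fixes d :: int
  assumes "d = j * n + a" "0 \<le> a" "a < n"
  shows "d div n = j" "d mod n = a" "n dvd d \<longleftrightarrow> a = 0"
  using assms n_pos by (auto simp: dvd_eq_mod_eq_0)

lemma rise_bottom: "\<not> n dvd c \<Longrightarrow> rise c = entry (2 * n * (c div n) - c)"
  by (simp add: rise_def)

text \<open>
  Following the diagonal forward over the top gives the same name as following it backward through the bottom.
  The two candidates differ by \<open>2n(k+1)\<close> or \<open>2n(k+2)\<close>, according to whether
  \<open>e\<close> lies beyond \<open>r\<close> in its block. This is a multiple of \<open>4n\<close> exactly
  where \<^const>\<open>separate\<close> asks for one, which is the reason for its definition.
\<close>

lemma rise_top:
  assumes "\<not> n dvd e"
  shows "rise (e - m) = entry (2 * n * (e div n + 1) - e + m)"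
proof -
  obtain j b where e: "e = j * n + b" "0 \<le> b" "b < n" "e div n = j" "n dvd e \<longleftrightarrow> b = 0"
    using block .
  have b: "0 < b" using e assms by simp
  define c where "c = e - m"
  consider "r < b" | "b < r" | "b = r" by linarith
  then show ?thesis
  proof cases
    case 1
    have c: "c = (j - k) * n + (b - r)" by (simp add: c_def e(1) m_def algebra_simps)
    have cb: "c div n = j - k" "\<not> n dvd c" using block_unique[OF c] 1 e r_ge by auto
    have "2 * n * (j - k) - c = (j - k - 1) * n + (n + r - b)" by (simp add: c algebra_simps)
    then have "(2 * n * (j - k) - c) mod n = n + r - b" by (rule block_unique) (use 1 e r_ge in auto)
    moreover have "even (k + 1) \<or> \<not> separate (n + r - b)" using 1 e r_less r_ge by (auto simp: separate_def)
    ultimately have "even (k + 1) \<or> \<not> separate ((2 * n * (j - k) - c) mod n)" by (simp only:)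
    moreover have "2 * n * (j + 1) - e + m = 2 * n * (j - k) - c + 2 * n * (k + 1)"
      by (simp add: c_def algebra_simps)
    ultimately have "entry (2 * n * (j + 1) - e + m) = entry (2 * n * (j - k) - c)"
      by (intro entry_shift)
    then show ?thesis using cb by (simp add: rise_def c_def[symmetric] e(4))
  next
    case 2
    have c: "c = (j - k - 1) * n + (n + b - r)" by (simp add: c_def e(1) m_def algebra_simps)
    have cb: "c div n = j - k - 1" "\<not> n dvd c" using block_unique[OF c] 2 e r_less by auto
    have "2 * n * (j - k - 1) - c = (j - k - 2 + 0) * n + (r - b)" by (simp add: c algebra_simps)
    then have "(2 * n * (j - k - 1) - c) mod n = r - b" by (rule block_unique) (use 2 b r_less in auto)
    moreover have "even (k + 2) \<or> \<not> separate (r - b)" using 2 b by (auto simp: separate_def)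
    ultimately have "even (k + 2) \<or> \<not> separate ((2 * n * (j - k - 1) - c) mod n)" by (simp only:)
    moreover have "2 * n * (j + 1) - e + m = 2 * n * (j - k - 1) - c + 2 * n * (k + 2)"
      by (simp add: c_def algebra_simps)
    ultimately have "entry (2 * n * (j + 1) - e + m) = entry (2 * n * (j - k - 1) - c)"
      by (intro entry_shift)
    then show ?thesis using cb by (simp add: rise_def c_def[symmetric] e(4))
  next
    case 3
    have c: "c = (j - k) * n" by (simp add: c_def e(1) m_def 3 algebra_simps)
    then have "n dvd c" "r \<noteq> 0" using 3 b by auto
    moreover have "c + 2 * n * (k + 1) = 2 * n * (j + 1) - e + m"
      by (simp add: c e(1) m_def 3 algebra_simps)
    ultimately show ?thesis by (simp add: rise_def c_def[symmetric] e(4))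
  qed
qed

text \<open>
  The labels on the end faces fit those on the tube: the square after \<open>d\<close> continues a path that
  comes down to \<open>d\<close>, and the square before \<open>d\<close> precedes a path that climbs from
  \<open>d\<close>.
\<close>

lemma label_rim_bottom:
  assumes "\<not> n dvd d"
  shows "label (even d) (rim_cap 0 d) = entry d" and "label (even d) (rim_cap 0 (d - 1)) = rise d"
proof -
  obtain v where v: "0 \<le> v" "v < 4 * n" "d mod (4 * n) = v mod (4 * n)"
    "(d - 1) mod (4 * n) = (v - 1) mod (4 * n)" "n dvd d \<longleftrightarrow> n dvd v" "even d \<longleftrightarrow> even v"
    using reduce_mod .
  have eqs: "rim_cap 0 d = rim_cap 0 v" "rim_cap 0 (d - 1) = rim_cap 0 (v - 1)" "entry d = entry v" "rise d = rise v"
    using rim_cap_mod entry_mod rise_mod v(3,4) by blast+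
  have inner: "\<not> n dvd v" using v assms by simp
  have 4: "entry (4 * n + x) = entry x" for x using entry_4n[of x 1] by (simp add: add.commute)
  have "label (even v) (rim_cap 0 v) = entry v \<and> label (even v) (rim_cap 0 (v - 1)) = rise v"
    using v(1,2) inner
  proof (cases rule: inner_face_cases)
    case 1
    then have rims: "rim v = (v, 0)" "rim (v - 1) = (v - 1, 0)"
      using rim_faces(1)[of v] rim_faces(1)[of "v - 1"] by simp_all
    have "v div n = 0" using block_unique(1)[of v 0 v] 1 by simp
    then have "rise v = entry (4 * n - v)" using rise_bottom[OF inner] 4[of "-v"] by simp
    then show ?thesis using 1 by (simp add: rim_cap_def rims up_label_def down_label_def)
  next
    case 2
    then have rims: "rim v = (n - 1, v - n)" "rim (v - 1) = (n - 1, v - 1 - n)"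
      using rim_faces(2)[of v] rim_faces(2)[of "v - 1"] by simp_all
    have "v div n = 1" using block_unique(1)[of v 1 "v - n"] 2 by simp
    then have "rise v = entry (2 * n - v)" using rise_bottom[OF inner] by simp
    moreover have "even (n - 1 + (v - n) + 0) \<longleftrightarrow> \<not> even v" "even (n - 1 + (v - 1 - n) + 0) \<longleftrightarrow> even v" by simp_all
    ultimately show ?thesis using 2 by (simp add: rim_cap_def rims up_label_def down_label_def del: even_add even_diff)
  next
    case 3
    then have rims: "rim v = (3 * n - 1 - v, n - 1)" "rim (v - 1) = (3 * n - v, n - 1)"
      using rim_faces(3)[of v] rim_faces(3)[of "v - 1"] by simp_all
    have "v div n = 2" using block_unique(1)[of v 2 "v - 2 * n"] 3 by simp
    then have "rise v = entry (4 * n - v)" using rise_bottom[OF inner] by simp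
    moreover have "even (3 * n - 1 - v + (n - 1) + 0) \<longleftrightarrow> even v" "even (3 * n - v + (n - 1) + 0) \<longleftrightarrow> \<not> even v" by presburger+
    ultimately show ?thesis using 3 by (simp add: rim_cap_def rims up_label_def down_label_def del: even_add even_diff)
  next
    case 4
    then have rims: "rim v = (0, 4 * n - 1 - v)" "rim (v - 1) = (0, 4 * n - v)"
      using rim_faces(4)[of v] rim_faces(4)[of "v - 1"] by simp_all
    have "v div n = 3" using block_unique(1)[of v 3 "v - 3 * n"] 4 by simp
    then have "rise v = entry (6 * n - v)" using rise_bottom[OF inner] by simp
    moreover have "even (0 + (4 * n - 1 - v) + 0) \<longleftrightarrow> \<not> even v" "even (0 + (4 * n - v) + 0) \<longleftrightarrow> even v" by presburger+
    ultimately show ?thesis using 4 by (simp add: rim_cap_def rims up_label_def down_label_def del: even_add even_diff)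
  qed
  then show "label (even d) (rim_cap 0 d) = entry d" "label (even d) (rim_cap 0 (d - 1)) = rise d"
    unfolding eqs v(6) by blast+
qed

lemma label_rim_top:
  assumes "\<not> n dvd d"
  shows "label (even (d + m)) (rim_cap m d) = rise (d - m)" and "label (even (d + m)) (rim_cap m (d - 1)) = entry (d + m)"
proof -
  obtain v where v: "0 \<le> v" "v < 4 * n" "d mod (4 * n) = v mod (4 * n)"
    "(d - 1) mod (4 * n) = (v - 1) mod (4 * n)" "n dvd d \<longleftrightarrow> n dvd v" "even d \<longleftrightarrow> even v"
    using reduce_mod .
  have "(d - m) mod (4 * n) = (v - m) mod (4 * n)" "(d + m) mod (4 * n) = (v + m) mod (4 * n)"
    using v(3) mod_diff_cong mod_add_cong by blast+
  then have eqs: "rim_cap m d = rim_cap m v" "rim_cap m (d - 1) = rim_cap m (v - 1)"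
    "entry (d + m) = entry (v + m)" "rise (d - m) = rise (v - m)"
    using rim_cap_mod entry_mod rise_mod v(3,4) by blast+
  have par: "even (d + m) \<longleftrightarrow> even (v + m)" using v(6) by simp
  have inner: "\<not> n dvd v" using v assms by simp
  have 4: "entry (4 * n + x) = entry x" for x using entry_4n[of x 1] by (simp add: add.commute)
  define P where "P \<longleftrightarrow> even (v + m)"
  have m0: "m \<noteq> 0" using m_pos by simp
  have "label P (rim_cap m v) = rise (v - m) \<and> label P (rim_cap m (v - 1)) = entry (v + m)"
    using v(1,2) inner
  proof (cases rule: inner_face_cases)
    case 1
    then have rims: "rim v = (v, 0)" "rim (v - 1) = (v - 1, 0)"
      using rim_faces(1)[of v] rim_faces(1)[of "v - 1"] by simp_all
    have "v div n = 0" using block_unique(1)[of v 0 v] 1 by simp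
    then have "rise (v - m) = entry (m + (2 * n - v))" using rise_top[OF inner] by (simp add: algebra_simps)
    moreover have "even (v + 0 + m) \<longleftrightarrow> P" "even (v - 1 + 0 + m) \<longleftrightarrow> \<not> P" unfolding P_def by presburger+
    ultimately show ?thesis using 1 m0
      by (simp add: rim_cap_def rims up_label_def down_label_def add.commute[of v m] del: even_add even_diff odd_add)
  next
    case 2
    then have rims: "rim v = (n - 1, v - n)" "rim (v - 1) = (n - 1, v - 1 - n)"
      using rim_faces(2)[of v] rim_faces(2)[of "v - 1"] by simp_all
    have "v div n = 1" using block_unique(1)[of v 1 "v - n"] 2 by simp
    then have "rise (v - m) = entry (m + (4 * n - v))" using rise_top[OF inner] by (simp add: algebra_simps)
    moreover have "even (n - 1 + (v - n) + m) \<longleftrightarrow> \<not> P" "even (n - 1 + (v - 1 - n) + m) \<longleftrightarrow> P" unfolding P_def by presburger+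
    ultimately show ?thesis using 2 m0
      by (simp add: rim_cap_def rims up_label_def down_label_def add.commute[of v m] del: even_add even_diff odd_add)
  next
    case 3
    then have rims: "rim v = (3 * n - 1 - v, n - 1)" "rim (v - 1) = (3 * n - v, n - 1)"
      using rim_faces(3)[of v] rim_faces(3)[of "v - 1"] by simp_all
    have "v div n = 2" using block_unique(1)[of v 2 "v - 2 * n"] 3 by simp
    then have "rise (v - m) = entry (4 * n + (m + (2 * n - v)))" using rise_top[OF inner] by (simp add: algebra_simps)
    then have "rise (v - m) = entry (m + (2 * n - v))" unfolding 4 .
    moreover have "even (3 * n - 1 - v + (n - 1) + m) \<longleftrightarrow> P" "even (3 * n - v + (n - 1) + m) \<longleftrightarrow> \<not> P" unfolding P_def by presburger+
    ultimately show ?thesis using 3 m0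
      by (simp add: rim_cap_def rims up_label_def down_label_def add.commute[of v m] del: even_add even_diff odd_add)
  next
    case 4
    then have rims: "rim v = (0, 4 * n - 1 - v)" "rim (v - 1) = (0, 4 * n - v)"
      using rim_faces(4)[of v] rim_faces(4)[of "v - 1"] by simp_all
    have "v div n = 3" using block_unique(1)[of v 3 "v - 3 * n"] 4 by simp
    then have "rise (v - m) = entry (4 * n + (m + (4 * n - v)))" using rise_top[OF inner] by (simp add: algebra_simps)
    then have "rise (v - m) = entry (m + (4 * n - v))" unfolding \<open>\<And>x. entry (4 * n + x) = entry x\<close> .
    moreover have "entry (m + (v - 4 * n)) = entry (v + m)" using \<open>\<And>x. entry (4 * n + x) = entry x\<close>[of "m + (v - 4 * n)"] by (simp add: algebra_simps)
    moreover have "even (0 + (4 * n - 1 - v) + m) \<longleftrightarrow> \<not> P" "even (0 + (4 * n - v) + m) \<longleftrightarrow> P" unfolding P_def by presburger+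
    ultimately show ?thesis using 4 m0
      by (simp add: rim_cap_def rims up_label_def down_label_def add.commute[of v m] del: even_add even_diff odd_add)
  qed
  then show "label (even (d + m)) (rim_cap m d) = rise (d - m)" "label (even (d + m)) (rim_cap m (d - 1)) = entry (d + m)"
    unfolding eqs par P_def by blast+
qed

section \<open>Labels are constant along diagonals\<close>

lemma label_cap_up: "even (x + y + h) = p \<Longrightarrow> x - y = i \<Longrightarrow> label p (Cap h x y) = up_label h i"
  and label_cap_down: "even (x + y + h) = (\<not> p) \<Longrightarrow> x + y + 1 = i \<Longrightarrow> label p (Cap h x y) = down_label h i"
  and label_tube_up: "even (u + z) = p \<Longrightarrow> u - z = c \<Longrightarrow> label p (Tube u z) = rise c"
  and label_tube_down: "even (u + z) = (\<not> p) \<Longrightarrow> u + z + 1 = d \<Longrightarrow> label p (Tube u z) = entry d"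
  by auto

lemma neighbourI: "adj v a b \<Longrightarrow> label p a = l \<Longrightarrow> label p b = l \<Longrightarrow> \<exists>b. adj v a b \<and> label p a = label p b"
  by metis

lemma rim_neighbours:
  assumes "\<not> n dvd d" "h = 0 \<or> h = m" "Cap h x y = rim_cap h d \<or> Cap h x y = rim_cap h (d - 1)"
  shows "\<exists>b. adj (tube_vertex d h) (Cap h x y) b \<and> label (even (d + h)) (Cap h x y) = label (even (d + h)) b"
proof -
  define z where "z = (if h = 0 then 0 else m - 1)"
  have zh: "z = 0 \<and> h = 0 \<or> z = m - 1 \<and> h = m" using assms(2) by (auto simp: z_def)
  note adjs = adj_rim[OF assms(1) zh]
  have 1: "label (even (d + h)) (rim_cap h d) = label (even (d + h)) (Tube (d - 1) z)"
    using zh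
  proof
    assume *: "z = 0 \<and> h = 0"
    then show ?thesis using label_rim_bottom(1)[OF assms(1)] by simp
  next
    assume *: "z = m - 1 \<and> h = m"
    have "even (d - 1 + (m - 1)) = even (d + m)" "d - 1 - (m - 1) = d - m" by presburger+
    then show ?thesis using label_rim_top(1)[OF assms(1)] * label_tube_up[of "d - 1" "m - 1" "even (d + m)" "d - m"] by simp
  qed
  have 2: "label (even (d + h)) (rim_cap h (d - 1)) = label (even (d + h)) (Tube d z)"
    using zh
  proof
    assume *: "z = 0 \<and> h = 0"
    then show ?thesis using label_rim_bottom(2)[OF assms(1)] by simp
  next
    assume *: "z = m - 1 \<and> h = m"
    have "even (d + (m - 1)) \<noteq> even (d + m)" "d + (m - 1) + 1 = d + m" by presburger+
    then show ?thesis using label_rim_top(2)[OF assms(1)] * label_tube_down[of d "m - 1" "even (d + m)" "d + m"] by simp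
  qed
  show ?thesis using adjs[THEN adj_sym] 1 2 assms(3) by metis
qed

lemma tube_vertex_rims:
  "0 < x \<Longrightarrow> x < n \<Longrightarrow> tube_vertex x h = (x, 0, h)"
  "0 < x \<Longrightarrow> x < n \<Longrightarrow> tube_vertex (n + x) h = (n, x, h)"
  "0 < x \<Longrightarrow> x < n \<Longrightarrow> tube_vertex (3 * n - x) h = (x, n, h)"
  "0 < x \<Longrightarrow> x < n \<Longrightarrow> tube_vertex (4 * n - x) h = (0, x, h)"
  using perimeter_faces(1)[of x] perimeter_faces(2)[of "n + x"] perimeter_faces(3)[of "3 * n - x"] perimeter_faces(4)[of "4 * n - x"]
  by (simp_all add: tube_vertex_def)

lemma rim_caps:
  "0 \<le> x \<Longrightarrow> x < n \<Longrightarrow> rim_cap h x = Cap h x 0"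
  "0 \<le> x \<Longrightarrow> x < n \<Longrightarrow> rim_cap h (n + x) = Cap h (n - 1) x"
  "0 \<le> x \<Longrightarrow> x < n \<Longrightarrow> rim_cap h (3 * n - 1 - x) = Cap h x (n - 1)"
  "0 \<le> x \<Longrightarrow> x < n \<Longrightarrow> rim_cap h (4 * n - 1 - x) = Cap h 0 x"
  using rim_faces(1)[of x] rim_faces(2)[of "n + x"] rim_faces(3)[of "3 * n - 1 - x"] rim_faces(4)[of "4 * n - 1 - x"]
  by (simp_all add: rim_cap_def)

lemma not_dvd_between:
  fixes x :: int
  assumes "0 < x" "x < n"
  shows "\<not> n dvd x" "\<not> n dvd n + x" "\<not> n dvd 3 * n - x" "\<not> n dvd 4 * n - x"
proof -
  show *: "\<not> n dvd x" using assms by (simp add: zdvd_not_zless)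
  then show "\<not> n dvd n + x" by simp
  show "\<not> n dvd 3 * n - x" "\<not> n dvd 4 * n - x"
    using * dvd_diff_right_iff[of n "3 * n" x] dvd_diff_right_iff[of n "4 * n" x] by simp_all
qed

text \<open>
  Every vertex on the boundary of an end face is one of the perimeter vertices, and a square there is the rim
  square before or after it.
\<close>

lemma rim_vertex:
  assumes "valid (Cap h x y)" "v \<in> square_of (Cap h x y)" "v \<notin> corners n n m"
    and "v = (i, j, h)" "i = 0 \<or> i = n \<or> j = 0 \<or> j = n"
  shows "\<exists>d. \<not> n dvd d \<and> v = tube_vertex d h \<and> (Cap h x y = rim_cap h d \<or> Cap h x y = rim_cap h (d - 1))"
proof -
  have ij: "i = x \<or> i = x + 1" "j = y \<or> j = y + 1" "0 \<le> i" "i \<le> n" "0 \<le> j" "j \<le> n"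
    and xy: "0 \<le> x" "x < n" "0 \<le> y" "y < n" and h: "h = 0 \<or> h = m"
    using assms(1,2) unfolding assms(4) by auto
  have nc: "\<not> ((i = 0 \<or> i = n) \<and> (j = 0 \<or> j = n))"
    using assms(3,4) h by (auto simp: corners_def)
  consider "j = 0" "0 < i" "i < n" | "i = n" "0 < j" "j < n" | "j = n" "0 < i" "i < n" | "i = 0" "0 < j" "j < n"
    using assms(5) nc ij(3-6) by (metis order_le_less)
  then show ?thesis
  proof cases
    case 1
    then have "y = 0" using ij(2) xy by auto
    have "Cap h x y = rim_cap h i \<or> Cap h x y = rim_cap h (i - 1)"
      using ij(1) rim_caps(1)[of x h] xy \<open>y = 0\<close> by auto
    then show ?thesis using not_dvd_between(1)[OF 1(2,3)] tube_vertex_rims(1)[OF 1(2,3), of h] 1 assms(4) by metis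
  next
    case 2
    then have "x = n - 1" using ij(1) xy by auto
    have "Cap h x y = rim_cap h (n + j) \<or> Cap h x y = rim_cap h (n + j - 1)"
      using ij(2) rim_caps(2)[of y h] xy \<open>x = n - 1\<close> by auto
    then show ?thesis using not_dvd_between(2)[OF 2(2,3)] tube_vertex_rims(2)[OF 2(2,3), of h] 2 assms(4) by metis
  next
    case 3
    then have "y = n - 1" using ij(2) xy by auto
    have "Cap h x y = rim_cap h (3 * n - i) \<or> Cap h x y = rim_cap h (3 * n - i - 1)"
      using ij(1) rim_caps(3)[of x h] xy \<open>y = n - 1\<close> by (auto simp: algebra_simps)
    then show ?thesis using not_dvd_between(3)[OF 3(2,3)] tube_vertex_rims(3)[OF 3(2,3), of h] 3 assms(4) by metis
  next
    case 4
    then have "x = 0" using ij(1) xy by auto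
    have "Cap h x y = rim_cap h (4 * n - j) \<or> Cap h x y = rim_cap h (4 * n - j - 1)"
      using ij(2) rim_caps(4)[of y h] xy \<open>x = 0\<close> by (auto simp: algebra_simps)
    then show ?thesis using not_dvd_between(4)[OF 4(2,3)] tube_vertex_rims(4)[OF 4(2,3), of h] 4 assms(4) by metis
  qed
qed

lemma even_vertex_shift:
  "even_vertex (x, y, z) \<longleftrightarrow> even (x + y + z)"
  by (simp add: even_vertex_def)

lemma cap_neighbour:
  assumes a: "valid (Cap h x y)" and v: "v \<in> square_of (Cap h x y)" "v \<notin> corners n n m"
  shows "\<exists>b. adj v (Cap h x y) b \<and> label (even_vertex v) (Cap h x y) = label (even_vertex v) b"
proof -
  obtain i j where ij: "v = (i, j, h)" "i = x \<or> i = x + 1" "j = y \<or> j = y + 1" using v(1) by auto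
  have h: "h = 0 \<or> h = m" using a by simp
  show ?thesis
  proof (cases "i = 0 \<or> i = n \<or> j = 0 \<or> j = n")
    case True
    then obtain d where d: "\<not> n dvd d" "v = tube_vertex d h" "Cap h x y = rim_cap h d \<or> Cap h x y = rim_cap h (d - 1)"
      using rim_vertex[OF a v ij(1)] by blast
    show ?thesis using rim_neighbours[OF d(1) h d(3)] unfolding d(2) even_tube_vertex .
  next
    case False
    have xy: "0 \<le> x" "x < n" "0 \<le> y" "y < n" using a by simp_all
    consider "i = x + 1" "j = y + 1" | "i = x" "j = y" | "i = x + 1" "j = y" | "i = x" "j = y + 1"
      using ij by blast
    then show ?thesis
    proof cases
      case 1
      then have *: "adj v (Cap h x y) (Cap h (x + 1) (y + 1))"
        using adj_cap_up[OF a] False xy ij(1) by simp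
      have p: "even_vertex v \<longleftrightarrow> even (x + y + h)" unfolding ij(1) 1 even_vertex_shift by presburger
      show ?thesis unfolding p by (rule neighbourI[OF *]; rule label_cap_up; presburger)
    next
      case 2
      have "valid (Cap h (x - 1) (y - 1))" using a False 2 xy by auto
      then have *: "adj v (Cap h x y) (Cap h (x - 1) (y - 1))"
        using adj_cap_up[of h "x - 1" "y - 1", THEN adj_sym] xy ij(1) 2 by simp
      have p: "even_vertex v \<longleftrightarrow> even (x + y + h)" unfolding ij(1) 2 even_vertex_shift by presburger
      show ?thesis unfolding p by (rule neighbourI[OF *]; rule label_cap_up; presburger)
    next
      case 3
      have "valid (Cap h (x + 1) (y - 1))" using a False 3 xy by auto
      then have *: "adj v (Cap h x y) (Cap h (x + 1) (y - 1))"
        using adj_cap_down[of h "x + 1" "y - 1", THEN adj_sym] xy ij(1) 3 by simp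
      have p: "even_vertex v \<longleftrightarrow> \<not> even (x + y + h)" unfolding ij(1) 3 even_vertex_shift by presburger
      show ?thesis unfolding p by (rule neighbourI[OF *]; rule label_cap_down; presburger)
    next
      case 4
      then have *: "adj v (Cap h x y) (Cap h (x - 1) (y + 1))"
        using adj_cap_down[OF a] False xy ij(1) by simp
      have p: "even_vertex v \<longleftrightarrow> \<not> even (x + y + h)" unfolding ij(1) 4 even_vertex_shift by presburger
      show ?thesis unfolding p by (rule neighbourI[OF *]; rule label_cap_down; presburger)
    qed
  qed
qed

lemma tube_neighbour:
  assumes a: "valid (Tube u z)" and v: "v \<in> square_of (Tube u z)" "v \<notin> corners n n m"
  shows "\<exists>b. adj v (Tube u z) b \<and> label (even_vertex v) (Tube u z) = label (even_vertex v) b"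
proof -
  have z: "0 \<le> z" "z < m" using a by simp_all
  consider "v = tube_vertex (u + 1) (z + 1)" | "v = tube_vertex u z" | "v = tube_vertex (u + 1) z" | "v = tube_vertex u (z + 1)"
    using v(1) by auto
  then show ?thesis
  proof cases
    case 1
    have p: "even_vertex v \<longleftrightarrow> even (u + z)" unfolding 1 even_tube_vertex by presburger
    show ?thesis
    proof (cases "z + 1 < m")
      case True
      have *: "adj v (Tube u z) (Tube (u + 1) (z + 1))" using adj_up[OF z(1) True, of u] 1 by simp
      show ?thesis unfolding p by (rule neighbourI[OF *]; rule label_tube_up; presburger)
    next
      case False
      then have z': "z = m - 1" using z by simp
      then have d: "\<not> n dvd u + 1" using v(2) 1 tube_vertex_corner by simp
      have *: "adj v (Tube u z) (rim_cap m (u + 1))" using adj_rim(1)[OF d, of z m] z' 1 by simp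
      have p': "even_vertex v \<longleftrightarrow> even (u + 1 + m)" unfolding p z' by presburger
      show ?thesis unfolding p'
        by (rule neighbourI[OF * _ label_rim_top(1)[OF d]]; rule label_tube_up; unfold z'; presburger)
    qed
  next
    case 2
    have p: "even_vertex v \<longleftrightarrow> even (u + z)" unfolding 2 even_tube_vertex by presburger
    show ?thesis
    proof (cases "z = 0")
      case True
      then have d: "\<not> n dvd u" using v(2) 2 tube_vertex_corner by simp
      have *: "adj v (Tube u z) (rim_cap 0 (u - 1))" using adj_rim(2)[OF d, of z 0] True 2 by simp
      have p': "even_vertex v \<longleftrightarrow> even u" unfolding p True by presburger
      show ?thesis unfolding p'
        by (rule neighbourI[OF * _ label_rim_bottom(2)[OF d]]; rule label_tube_up; unfold True; presburger)
    next
      case False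
      then have *: "adj v (Tube u z) (Tube (u - 1) (z - 1))"
        using adj_up[of "z - 1" "u - 1", THEN adj_sym] z 2 by simp
      show ?thesis unfolding p by (rule neighbourI[OF *]; rule label_tube_up; presburger)
    qed
  next
    case 3
    have p: "even_vertex v \<longleftrightarrow> \<not> even (u + z)" unfolding 3 even_tube_vertex by presburger
    show ?thesis
    proof (cases "z = 0")
      case True
      then have d: "\<not> n dvd u + 1" using v(2) 3 tube_vertex_corner by simp
      have *: "adj v (Tube u z) (rim_cap 0 (u + 1))" using adj_rim(1)[OF d, of z 0] True 3 by simp
      have p': "even_vertex v \<longleftrightarrow> even (u + 1)" unfolding p True by presburger
      show ?thesis unfolding p'
        by (rule neighbourI[OF * _ label_rim_bottom(1)[OF d]]; rule label_tube_down; unfold True; presburger)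
    next
      case False
      then have *: "adj v (Tube u z) (Tube (u + 1) (z - 1))"
        using adj_down[of "z - 1" "u + 1", THEN adj_sym] z 3 by simp
      show ?thesis unfolding p by (rule neighbourI[OF *]; rule label_tube_down; presburger)
    qed
  next
    case 4
    have p: "even_vertex v \<longleftrightarrow> \<not> even (u + z)" unfolding 4 even_tube_vertex by presburger
    show ?thesis
    proof (cases "z + 1 < m")
      case True
      have *: "adj v (Tube u z) (Tube (u - 1) (z + 1))" using adj_down[OF z(1) True, of u] 4 by simp
      show ?thesis unfolding p by (rule neighbourI[OF *]; rule label_tube_down; presburger)
    next
      case False
      then have z': "z = m - 1" using z by simp
      then have d: "\<not> n dvd u" using v(2) 4 tube_vertex_corner by simp
      have *: "adj v (Tube u z) (rim_cap m (u - 1))" using adj_rim(2)[OF d, of z m] z' 4 by simp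
      have p': "even_vertex v \<longleftrightarrow> even (u + m)" unfolding p z' by presburger
      show ?thesis unfolding p'
        by (rule neighbourI[OF * _ label_rim_top(2)[OF d]]; rule label_tube_down; unfold z'; presburger)
    qed
  qed
qed

text \<open>
  Only tube coordinates are ambiguous, and only by multiples of \<open>4n\<close>.
\<close>

lemma square_of_eq_label:
  assumes "valid a" "valid b" "square_of a = square_of b"
  shows "label p a = label p b"
proof (cases a; cases b)
  fix u z u' z' assume ab: "a = Tube u z" "b = Tube u' z'"
  note eq = assms(3)[unfolded ab]
  have mem: "tube_vertex u z \<in> square_of (Tube u' z')" "tube_vertex (u + 1) (z + 1) \<in> square_of (Tube u' z')"
    unfolding eq[symmetric] by simp_all
  have small: "\<not> 4 * n dvd 1" "\<not> 4 * n dvd 2" using n_pos by (simp_all add: not_dvd_small)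
  have z: "z = z'" using mem by (auto simp: tube_vertex_eq_iff)
  have "4 * n dvd u - u' \<or> 4 * n dvd u - (u' + 1)" "4 * n dvd (u + 1) - u' \<or> 4 * n dvd (u + 1) - (u' + 1)"
    using mem by (auto simp: tube_vertex_eq_iff)
  moreover have "\<not> (4 * n dvd u - (u' + 1) \<and> 4 * n dvd (u + 1) - u')"
    using small dvd_diff[of "4 * n" "(u + 1) - u'" "u - (u' + 1)"] by auto
  ultimately have d: "4 * n dvd u - u'" by auto
  have "(u - z) mod (4 * n) = (u' - z) mod (4 * n)" "(u + z + 1) mod (4 * n) = (u' + z + 1) mod (4 * n)"
    using d by (simp_all add: mod_eq_dvd_iff)
  then have "rise (u - z) = rise (u' - z)" "entry (u + z + 1) = entry (u' + z + 1)" using rise_mod entry_mod by blast+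
  moreover have "even (u + z) \<longleftrightarrow> even (u' + z)"
  proof -
    have "2 dvd u - u'" using d by (metis dvd_trans dvd_triv_left mult.assoc numeral_Bit0_eq_double)
    then show ?thesis by presburger
  qed
  ultimately show ?thesis unfolding ab z by (simp only: label.simps)
next
  fix u z h x y assume ab: "a = Tube u z" "b = Cap h x y"
  note eq = assms(3)[unfolded ab]
  have "tube_vertex u z \<in> square_of (Cap h x y)" "tube_vertex u (z + 1) \<in> square_of (Cap h x y)" unfolding eq[symmetric] by simp_all
  then have False by (auto simp: tube_vertex_def)
  then show ?thesis ..
next
  fix u z h x y assume ab: "a = Cap h x y" "b = Tube u z"
  note eq = assms(3)[unfolded ab]
  have "tube_vertex u z \<in> square_of (Cap h x y)" "tube_vertex u (z + 1) \<in> square_of (Cap h x y)" unfolding eq by simp_all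
  then have False by (auto simp: tube_vertex_def)
  then show ?thesis ..
next
  fix h x y h' x' y' assume ab: "a = Cap h x y" "b = Cap h' x' y'"
  note eq = assms(3)[unfolded ab]
  have "(x, y, h) \<in> square_of (Cap h' x' y')" "(x + 1, y + 1, h) \<in> square_of (Cap h' x' y')" unfolding eq[symmetric] by simp_all
  then show ?thesis unfolding ab by auto
qed

text \<open>
  The neighbour through a vertex is unique, so it is the one exhibited in coordinates above.
\<close>

lemma linked_same_label:
  assumes "valid a" "valid b" "linked n n m p (square_of a) (square_of b)"
  shows "label p a = label p b"
proof -
  obtain v where v: "diag_adjacent n n m v (square_of a) (square_of b)" "even_vertex v = p"
    using assms(3) unfolding linked_def by blast
  then have "v \<in> square_of a" "v \<notin> corners n n m" unfolding diag_adjacent_def by blast+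
  then have "\<exists>c. adj v a c \<and> label p a = label p c"
    using assms(1) unfolding v(2)[symmetric]
    by (cases a) (use tube_neighbour cap_neighbour in \<open>simp_all only:\<close>)
  then obtain c where c: "adj v a c" "label p a = label p c" by blast
  then have "square_of c = square_of b" using diagonal_neighbour_unique v(1) adj_iff by blast
  then show ?thesis using square_of_eq_label[of c b p] c assms(2) adj_iff by simp
qed

lemma linked_rtranclp_same_label:
  assumes "(linked n n m p)\<^sup>*\<^sup>* s t" "valid a" "square_of a = s" "valid b" "square_of b = t"
  shows "label p a = label p b"
  using assms
proof (induction arbitrary: b rule: rtranclp_induct)
  case base
  then show ?case using square_of_eq_label[of a b p] by blast
next
  case (step t t')
  have "t \<in> squares n n m" using step(2) unfolding linked_def diag_adjacent_def by blast
  then obtain c where c: "valid c" "square_of c = t" using in_squares_iff by blast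
  have "linked n n m p (square_of c) (square_of b)" using step.hyps(2) unfolding c(2) step.prems(4) .
  then have "label p c = label p b" by (rule linked_same_label[OF c(1) step.prems(3)])
  then show ?case using step.IH[OF step.prems(1,2) c] by (rule trans[rotated])
qed

section \<open>Diagonals are determined by their labels\<close>

text \<open>
  To show that squares with equal labels are connected, every square is joined to a standard square with the
  same label.
\<close>

definition joined :: "bool \<Rightarrow> coord \<Rightarrow> coord \<Rightarrow> bool" where
  "joined p a b \<longleftrightarrow> (linked n n m p)\<^sup>*\<^sup>* (square_of a) (square_of b)"

lemma joined_refl: "square_of a = square_of b \<Longrightarrow> joined p a b"
  by (simp add: joined_def)

lemma joined_sym: "joined p a b \<Longrightarrow> joined p b a"
  unfolding joined_def by (rule linked_rtranclp_sym)

lemma joined_trans [trans]: "joined p a b \<Longrightarrow> joined p b c \<Longrightarrow> joined p a c"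
  unfolding joined_def by (rule rtranclp_trans)

lemma adj_joined: "adj v a b \<Longrightarrow> even_vertex v = p \<Longrightarrow> joined p a b"
  unfolding joined_def by (rule r_into_rtranclp) (use adj_iff linked_def in blast)

lemma joined_up:
  assumes "0 \<le> z" "even (u + z) = p" "z + int i < m"
  shows "joined p (Tube u z) (Tube (u + int i) (z + int i))"
  using assms(3)
proof (induction i)
  case 0
  show ?case by (simp add: joined_refl)
next
  case (Suc i)
  define u' z' where "u' = u + int i" "z' = z + int i"
  have "adj (tube_vertex (u' + 1) (z' + 1)) (Tube u' z') (Tube (u' + 1) (z' + 1))"
    by (rule adj_up) (use assms(1) Suc.prems u'_z'_def in simp_all)
  moreover have "even_vertex (tube_vertex (u' + 1) (z' + 1)) = p"
    unfolding even_tube_vertex assms(2)[symmetric] u'_z'_def by presburger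
  ultimately have "joined p (Tube u' z') (Tube (u' + 1) (z' + 1))" by (rule adj_joined)
  moreover have "joined p (Tube u z) (Tube u' z')" unfolding u'_z'_def by (rule Suc.IH) (use Suc.prems in simp)
  moreover have "u' + 1 = u + int (Suc i)" "z' + 1 = z + int (Suc i)" by (simp_all add: u'_z'_def)
  ultimately show ?case using joined_trans by metis
qed

lemma joined_down:
  assumes "0 \<le> z" "even (u + z) = (\<not> p)" "z + int i < m"
  shows "joined p (Tube u z) (Tube (u - int i) (z + int i))"
  using assms(3)
proof (induction i)
  case 0
  show ?case by (simp add: joined_refl)
next
  case (Suc i)
  define u' z' where "u' = u - int i" "z' = z + int i"
  have "adj (tube_vertex u' (z' + 1)) (Tube u' z') (Tube (u' - 1) (z' + 1))"
    by (rule adj_down) (use assms(1) Suc.prems u'_z'_def in simp_all)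
  moreover have "even (u' + (z' + 1)) \<longleftrightarrow> \<not> even (u + z)" unfolding u'_z'_def by presburger
  then have "even_vertex (tube_vertex u' (z' + 1)) = p" unfolding even_tube_vertex assms(2) by blast
  ultimately have "joined p (Tube u' z') (Tube (u' - 1) (z' + 1))" by (rule adj_joined)
  moreover have "joined p (Tube u z) (Tube u' z')" unfolding u'_z'_def by (rule Suc.IH) (use Suc.prems in simp)
  moreover have "u' - 1 = u - int (Suc i)" "z' + 1 = z + int (Suc i)" by (simp_all add: u'_z'_def)
  ultimately show ?case using joined_trans by metis
qed

lemma joined_cap_up:
  assumes "valid (Cap h x y)" "even (x + y + h) = p" "x + int i < n" "y + int i < n"
  shows "joined p (Cap h x y) (Cap h (x + int i) (y + int i))"
  using assms(3,4)
proof (induction i)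
  case 0
  show ?case by (simp add: joined_refl)
next
  case (Suc i)
  define x' y' where "x' = x + int i" "y' = y + int i"
  have "adj (x' + 1, y' + 1, h) (Cap h x' y') (Cap h (x' + 1) (y' + 1))"
    by (rule adj_cap_up) (use assms(1) Suc.prems x'_y'_def in simp_all)
  moreover have "even_vertex (x' + 1, y' + 1, h) = p"
    unfolding even_vertex_shift assms(2)[symmetric] x'_y'_def by presburger
  ultimately have "joined p (Cap h x' y') (Cap h (x' + 1) (y' + 1))" by (rule adj_joined)
  moreover have "joined p (Cap h x y) (Cap h x' y')" unfolding x'_y'_def by (rule Suc.IH) (use Suc.prems in simp_all)
  moreover have "x' + 1 = x + int (Suc i)" "y' + 1 = y + int (Suc i)" by (simp_all add: x'_y'_def)
  ultimately show ?case using joined_trans by metis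
qed

lemma joined_cap_down:
  assumes "valid (Cap h x y)" "even (x + y + h) = (\<not> p)" "0 \<le> x - int i" "y + int i < n"
  shows "joined p (Cap h x y) (Cap h (x - int i) (y + int i))"
  using assms(3,4)
proof (induction i)
  case 0
  show ?case by (simp add: joined_refl)
next
  case (Suc i)
  define x' y' where "x' = x - int i" "y' = y + int i"
  have "adj (x', y' + 1, h) (Cap h x' y') (Cap h (x' - 1) (y' + 1))"
    by (rule adj_cap_down) (use assms(1) Suc.prems x'_y'_def in simp_all)
  moreover have "even (x' + (y' + 1) + h) \<longleftrightarrow> \<not> even (x + y + h)" unfolding x'_y'_def by presburger
  then have "even_vertex (x', y' + 1, h) = p" unfolding even_vertex_shift assms(2) by blast
  ultimately have "joined p (Cap h x' y') (Cap h (x' - 1) (y' + 1))" by (rule adj_joined)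
  moreover have "joined p (Cap h x y) (Cap h x' y')" unfolding x'_y'_def by (rule Suc.IH) (use Suc.prems in simp_all)
  moreover have "x' - 1 = x - int (Suc i)" "y' + 1 = y + int (Suc i)" by (simp_all add: x'_y'_def)
  ultimately show ?case using joined_trans by metis
qed

lemma joined_cap_up_line:
  assumes "valid (Cap h x y)" "valid (Cap h x' y')" "even (x + y + h) = p" "x - y = x' - y'"
  shows "joined p (Cap h x y) (Cap h x' y')"
proof -
  have *: "joined p (Cap h x y) (Cap h x' y')"
    if "valid (Cap h x y)" "valid (Cap h x' y')" "even (x + y + h) = p" "x - y = x' - y'" "x \<le> x'" for x y x' y'
  proof -
    have "x' = x + int (nat (x' - x))" "y' = y + int (nat (x' - x))" using that by simp_all
    then show ?thesis using joined_cap_up[OF that(1,3), of "nat (x' - x)"] that(2) by simp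
  qed
  have "even (x' + y' + h) \<longleftrightarrow> even (x + y + h)" using assms(4) by presburger
  then show ?thesis using *[of x y x' y'] *[of x' y' x y, THEN joined_sym] assms by linarith
qed

lemma joined_cap_down_line:
  assumes "valid (Cap h x y)" "valid (Cap h x' y')" "even (x + y + h) = (\<not> p)" "x + y = x' + y'"
  shows "joined p (Cap h x y) (Cap h x' y')"
proof -
  have *: "joined p (Cap h x y) (Cap h x' y')"
    if "valid (Cap h x y)" "valid (Cap h x' y')" "even (x + y + h) = (\<not> p)" "x + y = x' + y'" "x' \<le> x" for x y x' y'
  proof -
    have "x' = x - int (nat (x - x'))" "y' = y + int (nat (x - x'))" using that by simp_all
    then show ?thesis using joined_cap_down[OF that(1,3), of "nat (x - x')"] that(2) by simp
  qed
  have "even (x' + y' + h) \<longleftrightarrow> even (x + y + h)" using assms(4) by presburger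
  then show ?thesis using *[of x y x' y'] *[of x' y' x y, THEN joined_sym] assms by linarith
qed

text \<open>
  A path that enters an end face at the perimeter position \<open>d\<close> leaves it at \<open>turn d\<close>,
  the mirror image of \<open>d\<close> in the next corner.
\<close>

definition turn :: "int \<Rightarrow> int" where
  "turn d = 2 * n * (d div n + 1) - d"

lemma turn_mod:
  assumes "d mod (4 * n) = v mod (4 * n)"
  shows "turn d mod (4 * n) = turn v mod (4 * n)" "(turn d - 1) mod (4 * n) = (turn v - 1) mod (4 * n)"
proof -
  obtain q where "d - v = 4 * n * q" using assms unfolding mod_eq_dvd_iff by (rule dvdE)
  then have d: "d = v + n * (4 * q)" by (simp add: algebra_simps)
  have "d div n = v div n + 4 * q" unfolding d using n_pos by simp
  then have "turn d - turn v = 4 * n * q" unfolding turn_def by (simp add: d algebra_simps)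
  then show "turn d mod (4 * n) = turn v mod (4 * n)" unfolding mod_eq_dvd_iff by simp
  then show "(turn d - 1) mod (4 * n) = (turn v - 1) mod (4 * n)" by (rule mod_diff_cong) simp
qed

lemma turn_block: "d = j * n + a \<Longrightarrow> 0 \<le> a \<Longrightarrow> a < n \<Longrightarrow> turn d = (j + 2) * n - a"
  unfolding turn_def by (simp add: block_unique(1) algebra_simps)

lemma joined_across_cap:
  assumes "\<not> n dvd d" "h = 0 \<or> h = m" "even (d + h) = p"
  shows "joined p (rim_cap h d) (rim_cap h (turn d - 1))"
proof -
  obtain v where v: "0 \<le> v" "v < 4 * n" "d mod (4 * n) = v mod (4 * n)" "n dvd d \<longleftrightarrow> n dvd v" "even d \<longleftrightarrow> even v"
    using reduce_mod .
  have eqs: "rim_cap h d = rim_cap h v" "rim_cap h (turn d - 1) = rim_cap h (turn v - 1)"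
    using rim_cap_mod v(3) turn_mod(2)[OF v(3)] by blast+
  have p: "even (v + h) = p" using assms(3) v(5) by simp
  have "\<not> n dvd v" using v assms by simp
  with v(1,2) show ?thesis unfolding eqs
  proof (cases rule: inner_face_cases)
    case 1
    have t: "turn v - 1 = n + (n - 1 - v)" using turn_block[of v 0 v] 1 by simp
    have "rim_cap h v = Cap h v 0" "rim_cap h (turn v - 1) = Cap h (n - 1) (n - 1 - v)"
      unfolding t using 1 rim_caps(1)[of v h] rim_caps(2)[of "n - 1 - v" h] by simp_all
    moreover have "even (v + 0 + h) = p" using p by simp
    ultimately show "joined p (rim_cap h v) (rim_cap h (turn v - 1))"
      using 1 assms(2) by (simp only:) (rule joined_cap_up_line; simp)
  next
    case 2
    have t: "turn v - 1 = 3 * n - 1 - (v - n)" using turn_block[of v 1 "v - n"] 2 by simp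
    have "rim_cap h v = Cap h (n - 1) (v - n)" "rim_cap h (turn v - 1) = Cap h (v - n) (n - 1)"
      unfolding t using 2 rim_caps(2)[of "v - n" h] rim_caps(3)[of "v - n" h] by simp_all
    moreover have "even (n - 1 + (v - n) + h) \<longleftrightarrow> \<not> even (v + h)" by presburger
    ultimately show "joined p (rim_cap h v) (rim_cap h (turn v - 1))"
      unfolding p using 2 assms(2) by (simp only:) (rule joined_cap_down_line; simp)
  next
    case 3
    have t: "turn v - 1 = 4 * n - 1 - (v - 2 * n)" using turn_block[of v 2 "v - 2 * n"] 3 by simp
    have "rim_cap h v = Cap h (3 * n - 1 - v) (n - 1)" "rim_cap h (turn v - 1) = Cap h 0 (v - 2 * n)"
      unfolding t using 3 rim_caps(3)[of "3 * n - 1 - v" h] rim_caps(4)[of "v - 2 * n" h] by simp_all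
    moreover have "even (3 * n - 1 - v + (n - 1) + h) \<longleftrightarrow> even (v + h)" by presburger
    ultimately show "joined p (rim_cap h v) (rim_cap h (turn v - 1))"
      unfolding p using 3 assms(2) by (simp only:) (rule joined_cap_up_line; simp)
  next
    case 4
    have t: "turn v = 8 * n - v" using turn_block[of v 3 "v - 3 * n"] 4 by simp
    have "rim_cap h (turn v - 1) = rim_cap h (4 * n - 1 - v)"
      by (rule rim_cap_mod) (simp add: t mod_eq_dvd_iff)
    then have "rim_cap h v = Cap h 0 (4 * n - 1 - v)" "rim_cap h (turn v - 1) = Cap h (4 * n - 1 - v) 0"
      using 4 rim_caps(4)[of "4 * n - 1 - v" h] rim_caps(1)[of "4 * n - 1 - v" h] by simp_all
    moreover have "even (0 + (4 * n - 1 - v) + h) \<longleftrightarrow> \<not> even (v + h)" by presburger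
    ultimately show "joined p (rim_cap h v) (rim_cap h (turn v - 1))"
      unfolding p using 4 assms(2) by (simp only:) (rule joined_cap_down_line; simp)
  qed
qed

lemma not_dvd_turn: "\<not> n dvd d \<Longrightarrow> \<not> n dvd turn d"
  unfolding turn_def using dvd_diff_right_iff[of n "2 * n * (d div n + 1)" d] by simp

lemma even_turn: "even (turn d) \<longleftrightarrow> even d"
  unfolding turn_def by simp

lemma joined_through_cap:
  assumes d: "\<not> n dvd d" and zh: "z = 0 \<and> h = 0 \<or> z = m - 1 \<and> h = m" and p: "even (d + h) = p"
  shows "joined p (Tube (d - 1) z) (rim_cap h d)" "joined p (Tube (turn d) z) (rim_cap h (turn d - 1))"
    "joined p (Tube (d - 1) z) (Tube (turn d) z)"
proof -
  have h: "h = 0 \<or> h = m" using zh by blast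
  have p': "even (turn d + h) = p" using p even_turn by simp
  show 1: "joined p (Tube (d - 1) z) (rim_cap h d)"
    using adj_joined[OF adj_rim(1)[OF d zh]] p even_tube_vertex by blast
  show 2: "joined p (Tube (turn d) z) (rim_cap h (turn d - 1))"
    using adj_joined[OF adj_rim(2)[OF not_dvd_turn[OF d] zh]] p' even_tube_vertex by blast
  show "joined p (Tube (d - 1) z) (Tube (turn d) z)"
    using joined_trans[OF joined_trans[OF 1 joined_across_cap[OF d h p]] joined_sym[OF 2]] .
qed

lemma joined_straight_up: "0 \<le> z \<Longrightarrow> z < m \<Longrightarrow> even c = p \<Longrightarrow> joined p (Tube c 0) (Tube (c + z) z)"
  using joined_up[of 0 c p "nat z"] by simp

lemma joined_straight_down: "0 \<le> z \<Longrightarrow> z < m \<Longrightarrow> even d = p \<Longrightarrow> joined p (Tube (d - 1) 0) (Tube (d - 1 - z) z)"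
  using joined_down[of 0 "d - 1" p "nat z"] by simp

lemma joined_over_top:
  assumes "\<not> n dvd e" "even (e - m) = p"
  shows "joined p (Tube (e - m) 0) (Tube (turn e + m - 1) 0)"
proof -
  have "joined p (Tube (e - m) 0) (Tube (e - 1) (m - 1))"
    using joined_straight_up[of "m - 1" "e - m" p] assms(2) m_pos by simp
  also have "joined p (Tube (e - 1) (m - 1)) (Tube (turn e) (m - 1))"
    using joined_through_cap(3)[OF assms(1), of "m - 1" m p] assms(2) by simp
  also have "joined p (Tube (turn e) (m - 1)) (Tube (turn e + m - 1) 0)"
  proof -
    have "even (turn e + m) = p" using assms(2) even_turn by simp
    then show ?thesis using joined_straight_down[of "m - 1" "turn e + m" p] m_pos joined_sym by simp
  qed
  finally show ?thesis .
qed

text \<open>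
  One full circuit through the bottom and the top shifts an entry by \<open>2n(k+1)\<close> or
  \<open>2n(k+2)\<close>. If its residue is not separate, the factor of \<open>2n\<close> is odd, and the shift
  is half a turn around the perimeter.
\<close>

lemma joined_half_turn:
  assumes ns: "\<not> separate (d mod n)" and p: "even d = p"
  shows "joined p (Tube (d - 1) 0) (Tube (d + 2 * n - 1) 0)"
proof -
  obtain j a where d: "d = j * n + a" "0 \<le> a" "a < n" "d mod n = a" "n dvd d \<longleftrightarrow> a = 0"
    using block .
  have a: "a \<noteq> 0" "a \<noteq> r" "if even k then r < a else a < r"
    using ns unfolding d(4) separate_def by (auto split: if_splits)
  define e where "e = turn d + m"
  have t: "turn d = (j + 2) * n - a" by (rule turn_block[OF d(1-3)])
  have nd: "\<not> n dvd d" using d a by simp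
  have e: "\<not> n dvd e \<and> (\<exists>i. turn e + m = d + 2 * n * (2 * i + 1))"
  proof (cases "even k")
    case True
    then obtain q where q: "k = 2 * q" by blast
    have e: "e = (j + 1 + k) * n + (n - a + r)" by (simp add: e_def t m_def algebra_simps)
    have ea: "0 < n - a + r" "n - a + r < n" using a(3) d r_ge True by simp_all
    have "turn e + m = d + 2 * n * (k + 1)"
      using turn_block[OF e] ea by (simp add: d(1) m_def algebra_simps)
    moreover have "k + 1 = 2 * q + 1" using q by simp
    moreover have "\<not> n dvd e" using block_unique(3)[OF e] ea by simp
    ultimately show ?thesis by metis
  next
    case False
    then obtain q where q: "k = 2 * q + 1" by (rule oddE)
    have e: "e = (j + 2 + k) * n + (r - a)" by (simp add: e_def t m_def algebra_simps)
    have ea: "0 < r - a" "r - a < n" using a(3) d r_less False by simp_all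
    have "turn e + m = d + 2 * n * (k + 2)"
      using turn_block[OF e] ea by (simp add: d(1) m_def algebra_simps)
    moreover have "k + 2 = 2 * (q + 1) + 1" using q by simp
    moreover have "\<not> n dvd e" using block_unique(3)[OF e] ea by simp
    ultimately show ?thesis by metis
  qed
  then obtain i where i: "turn e + m = d + 2 * n * (2 * i + 1)" by blast
  have "joined p (Tube (d - 1) 0) (Tube (turn d) 0)"
    using joined_through_cap(3)[OF nd, of 0 0 p] p by simp
  also have "joined p (Tube (turn d) 0) (Tube (turn e + m - 1) 0)"
    using joined_over_top[of e p] e p even_turn[of d] by (simp add: e_def)
  also have "joined p (Tube (turn e + m - 1) 0) (Tube (d + 2 * n - 1) 0)"
    by (rule joined_refl, rule square_of_Tube_mod) (simp add: i mod_eq_dvd_iff algebra_simps)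
  finally show ?thesis .
qed

text \<open>
  The standard square of a label: the last one before the entry, the first one after a start in a corner, or the
  end of a main diagonal.
\<close>

fun canon :: "diagonal_label \<Rightarrow> coord" where
  "canon (Entry d) = Tube (d - 1) 0"
| "canon (Rise c) = Tube c 0"
| "canon (Medial h i) = (if i = 0 then Cap h 0 0 else Cap h (n - 1) 0)"

lemma joined_entry:
  assumes p: "even d = p"
  shows "joined p (Tube (d - 1) 0) (canon (entry d))"
proof -
  have same: "joined p (Tube (d - 1) 0) (Tube (d' - 1) 0)" if "d mod (4 * n) = d' mod (4 * n)" for d d'
    by (rule joined_refl, rule square_of_Tube_mod) (rule mod_diff_cong[OF that refl])
  show ?thesis
  proof (cases "separate (d mod n)")
    case True
    then show ?thesis using same[of d "d mod (4 * n)"] by (simp add: entry_def)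
  next
    case False
    define q where "q = d div (2 * n)"
    have d: "d = d mod (2 * n) + 2 * n * q" by (simp add: q_def)
    have "joined p (Tube (d - 1) 0) (Tube (d mod (2 * n) - 1) 0)"
    proof (cases "even q")
      case True
      then obtain i where "q = 2 * i" by blast
      then have "d - d mod (2 * n) = 4 * n * i" using d by simp
      then have "4 * n dvd d - d mod (2 * n)" by simp
      then show ?thesis by (intro same) (simp only: mod_eq_dvd_iff)
    next
      case odd: False
      then obtain i where "q = 2 * i + 1" by (rule oddE)
      then have "d + 2 * n - d mod (2 * n) = 4 * n * (i + 1)" using d by (simp add: algebra_simps)
      then have "4 * n dvd d + 2 * n - d mod (2 * n)" by simp
      then have "joined p (Tube (d + 2 * n - 1) 0) (Tube (d mod (2 * n) - 1) 0)"
        by (intro same) (simp only: mod_eq_dvd_iff)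
      then show ?thesis using joined_half_turn[OF False p] joined_trans by blast
    qed
    then show ?thesis using False by (simp add: entry_def)
  qed
qed

text \<open>
  The three cases follow the definition of \<^const>\<open>rise\<close>: back through the bottom, no entry at
  all, or forward over the top.
\<close>

lemma joined_rise:
  assumes p: "even c = p"
  shows "joined p (Tube c 0) (canon (rise c))"
proof (cases "n dvd c")
  case False
  obtain j b where c: "c = j * n + b" "0 \<le> b" "b < n" "c div n = j" "n dvd c \<longleftrightarrow> b = 0"
    using block .
  define d where "d = 2 * n * (c div n) - c"
  have d: "d = (j - 1) * n + (n - b)" by (simp add: d_def c(4)) (simp add: c(1) algebra_simps)
  have nd: "\<not> n dvd d" using block_unique(3)[OF d] c False by simp
  have "turn d = c" using turn_block[OF d] c False by (simp add: algebra_simps)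
  moreover have ed: "even d = p" using p by (simp add: d_def)
  ultimately have "joined p (Tube (d - 1) 0) (Tube c 0)"
    using joined_through_cap(3)[OF nd, of 0 0 p] by simp
  from joined_trans[OF joined_sym[OF this] joined_entry[OF ed]] have "joined p (Tube c 0) (canon (entry d))" .
  then show ?thesis using False by (simp add: rise_def d_def)
next
  case True
  then obtain j where c: "c = j * n" by (metis dvdE mult.commute)
  show ?thesis
  proof (cases "r = 0")
    case r0: True
    have "joined p (Tube c 0) (Tube (c mod (4 * n)) 0)"
      by (rule joined_refl, rule square_of_Tube_mod) simp
    moreover have "rise c = Rise (c mod (4 * n))" unfolding rise_def if_P[OF True] if_P[OF r0] ..
    ultimately show ?thesis by simp
  next
    case r0: False
    define e where "e = c + m"
    have e: "e = (j + k) * n + r" by (simp add: e_def c m_def algebra_simps)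
    have "\<not> n dvd e" using block_unique(3)[OF e r_ge r_less] r0 by simp
    moreover have "turn e + m = c + 2 * n * (k + 1)"
      using turn_block[OF e r_ge r_less] by (simp add: c m_def algebra_simps)
    ultimately have 1: "joined p (Tube c 0) (Tube (c + 2 * n * (k + 1) - 1) 0)"
      using joined_over_top[of e p] p by (simp add: e_def)
    have 2: "even (c + 2 * n * (k + 1)) = p" using p by simp
    have "rise c = entry (c + 2 * n * (k + 1))" unfolding rise_def if_P[OF True] if_not_P[OF r0] ..
    then show ?thesis using joined_trans[OF 1 joined_entry[OF 2]] by simp
  qed
qed

lemma joined_canon_tube:
  assumes "0 \<le> z" "z < m"
  shows "joined p (Tube u z) (canon (label p (Tube u z)))"
proof (cases "even (u + z) = p")
  case True
  have c: "even (u - z) = p" unfolding True[symmetric] by presburger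
  have "joined p (Tube (u - z) 0) (Tube u z)" using joined_straight_up[OF assms c] by simp
  from joined_trans[OF joined_sym[OF this] joined_rise[OF c]] show ?thesis
    using label_tube_up[OF True refl] by simp
next
  case False
  then have F: "even (u + z) = (\<not> p)" by blast
  have "even (u + z + 1) \<longleftrightarrow> \<not> even (u + z)" by presburger
  then have d: "even (u + z + 1) = p" using False by blast
  have "joined p (Tube (u + z + 1 - 1) 0) (Tube u z)" using joined_straight_down[OF assms d] by simp
  from joined_trans[OF joined_sym[OF this] joined_entry[OF d]] show ?thesis
    using label_tube_down[OF F refl] by simp
qed

lemma joined_canon_bottom_rim:
  assumes "\<not> n dvd d" "even d = p" "joined p a (rim_cap 0 d)" "label p a = entry d"
  shows "joined p a (canon (label p a))"
proof -
  have "joined p (rim_cap 0 d) (Tube (d - 1) 0)"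
    using joined_through_cap(1)[OF assms(1), of 0 0 p] assms(2) joined_sym by simp
  from joined_trans[OF joined_trans[OF assms(3) this] joined_entry[OF assms(2)]] show ?thesis
    unfolding assms(4) .
qed

lemma joined_canon_top_rim:
  assumes "\<not> n dvd d" "even (d + m) = p" "joined p a (rim_cap m (d - 1))" "label p a = entry (m + d)"
  shows "joined p a (canon (label p a))"
proof -
  have "joined p (rim_cap m (d - 1)) (Tube d (m - 1))"
  proof -

    have "adj (tube_vertex d m) (Tube d (m - 1)) (rim_cap m (d - 1))" by (rule adj_rim(2)[OF assms(1)]) simp
    moreover have "even_vertex (tube_vertex d m) = p" unfolding even_tube_vertex by (rule assms(2))
    ultimately show ?thesis by (rule adj_joined[THEN joined_sym])
  qed
  note joined_trans[OF assms(3) this]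
  also have "joined p (Tube d (m - 1)) (Tube (d + m - 1) 0)"
    using joined_straight_down[of "m - 1" "d + m" p] m_pos assms(2) joined_sym by simp
  finally have "joined p a (Tube (d + m - 1) 0)" .
  from joined_trans[OF this joined_entry[OF assms(2)]] show ?thesis
    unfolding assms(4) by (simp add: add.commute)
qed

lemma joined_canon_cap:
  assumes a: "valid (Cap h x y)"
  shows "joined p (Cap h x y) (canon (label p (Cap h x y)))"
proof -
  have xy: "0 \<le> x" "x < n" "0 \<le> y" "y < n" and h: "h = 0 \<or> h = m" using a by simp_all
  show ?thesis
  proof (cases "even (x + y + h) = p")
    case True
    note up = joined_cap_up_line[OF a _ True] and l = label_cap_up[OF True refl]
    have v: "valid (Cap h i j)" if "0 \<le> i" "i < n" "0 \<le> j" "j < n" for i j using that h by simp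
    consider "x = y" | "y < x" "h = 0" | "y < x" "h = m" "h \<noteq> 0" | "x < y" "h = 0" | "x < y" "h = m" "h \<noteq> 0"
      using h by linarith
    then show ?thesis
    proof cases
      case 1
      then have "joined p (Cap h x y) (Cap h 0 0)" using up[OF v[of 0 0]] n_pos by simp
      then show ?thesis unfolding l using 1 by (simp add: up_label_def)
    next
      case 2
      have "rim_cap 0 (x - y) = Cap 0 (x - y) 0" using rim_caps(1)[of "x - y" 0] 2 xy by simp
      then have R: "rim_cap 0 (x - y) = Cap h (x - y) 0" unfolding 2(2) .
      have "joined p (Cap h x y) (Cap h (x - y) 0)"
        by (rule up[OF v]) (use 2 xy n_pos in linarith)+
      then have "joined p (Cap h x y) (rim_cap 0 (x - y))" unfolding R .
      then show ?thesis
        using not_dvd_between(1)[of "x - y"] xy 2 True l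
        by (intro joined_canon_bottom_rim[of "x - y"]) (simp_all add: up_label_def)
    next
      case 3
      have e: "n + (n - 1 - (x - y)) = 2 * n - (x - y) - 1" by simp
      have "rim_cap m (2 * n - (x - y) - 1) = Cap m (n - 1) (n - 1 - (x - y))"
        using rim_caps(2)[of "n - 1 - (x - y)" m] 3 xy unfolding e by simp
      then have R: "rim_cap m (2 * n - (x - y) - 1) = Cap h (n - 1) (n - 1 - (x - y))" unfolding 3(2) .
      have "joined p (Cap h x y) (Cap h (n - 1) (n - 1 - (x - y)))"
        by (rule up[OF v]) (use 3 xy n_pos in linarith)+
      then have "joined p (Cap h x y) (rim_cap m (2 * n - (x - y) - 1))" unfolding R .
      moreover have "\<not> n dvd 2 * n - (x - y)" using not_dvd_between(1)[of "x - y"] dvd_diff_right_iff[of n "2 * n" "x - y"] 3 xy by simp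
      moreover have "even (2 * n - (x - y) + m) = p" unfolding True[symmetric] 3(2) by presburger
      ultimately show ?thesis
        using 3 l by (intro joined_canon_top_rim[of "2 * n - (x - y)"]) (simp_all add: up_label_def)
    next
      case 4
      have e: "3 * n - 1 - (n - 1 - (y - x)) = 2 * n - (x - y)" by simp
      have "rim_cap 0 (2 * n - (x - y)) = Cap 0 (n - 1 - (y - x)) (n - 1)"
        using rim_caps(3)[of "n - 1 - (y - x)" 0] 4 xy unfolding e by simp
      then have R: "rim_cap 0 (2 * n - (x - y)) = Cap h (n - 1 - (y - x)) (n - 1)" unfolding 4(2) .
      have "joined p (Cap h x y) (Cap h (n - 1 - (y - x)) (n - 1))"
        by (rule up[OF v]) (use 4 xy n_pos in linarith)+
      then have "joined p (Cap h x y) (rim_cap 0 (2 * n - (x - y)))" unfolding R .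
      moreover have e2: "2 * n - (x - y) = n * 2 + (y - x)" by simp
      have "\<not> n dvd y - x" by (rule not_dvd_between(1)) (use 4 xy in simp_all)
      then have "\<not> n dvd 2 * n - (x - y)"
        unfolding e2 using dvd_add_right_iff[of n "n * 2" "y - x"] dvd_triv_left[of n 2] by blast
      moreover have "even (2 * n - (x - y)) = p" unfolding True[symmetric] 4(2) by presburger
      ultimately show ?thesis
        using 4 l by (intro joined_canon_bottom_rim[of "2 * n - (x - y)"]) (simp_all add: up_label_def)
    next
      case 5
      have "rim_cap m (x - y - 1) = rim_cap m (4 * n - 1 - (y - x))"
        by (rule rim_cap_mod) (simp add: mod_eq_dvd_iff)
      then have "rim_cap m (x - y - 1) = Cap m 0 (y - x)"
        using rim_caps(4)[of "y - x" m] 5 xy by simp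
      then have R: "rim_cap m (x - y - 1) = Cap h 0 (y - x)" unfolding 5(2) .
      have "joined p (Cap h x y) (Cap h 0 (y - x))"
        by (rule up[OF v]) (use 5 xy n_pos in linarith)+
      then have "joined p (Cap h x y) (rim_cap m (x - y - 1))" unfolding R .
      moreover have "\<not> n dvd x - y"
        using not_dvd_between(1)[of "y - x"] 5 xy dvd_minus_iff[of n "x - y"] by simp
      moreover have "even (x - y + m) = p" unfolding True[symmetric] 5(2) by presburger
      ultimately show ?thesis
        using 5 l by (intro joined_canon_top_rim[of "x - y"]) (simp_all add: up_label_def)
    qed
  next
    case False
    then have F: "even (x + y + h) = (\<not> p)" by blast
    define s where "s = x + y + 1"
    have "even (s + h) \<longleftrightarrow> \<not> even (x + y + h)" unfolding s_def by presburger
    then have p: "even (s + h) = p" using F by blast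
    note down = joined_cap_down_line[OF a _ F] and l = label_cap_down[OF F refl, folded s_def]
    have v: "valid (Cap h i j)" if "0 \<le> i" "i < n" "0 \<le> j" "j < n" for i j using that h by simp
    have s: "0 < s" "s < 2 * n" using xy by (simp_all add: s_def)
    consider "s = n" | "n < s" "h = 0" | "n < s" "h = m" "h \<noteq> 0" | "s < n" "h = 0" | "s < n" "h = m" "h \<noteq> 0"
      using h by linarith
    then show ?thesis
    proof cases
      case 1
      then have "joined p (Cap h x y) (Cap h (n - 1) 0)"
        using down[OF v[of "n - 1" 0]] n_pos by (simp add: s_def)
      then show ?thesis unfolding l using 1 by (simp add: down_label_def)
    next
      case 2
      have "rim_cap 0 s = Cap 0 (n - 1) (s - n)" using rim_caps(2)[of "s - n" 0] 2 s by simp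
      then have R: "rim_cap 0 s = Cap h (n - 1) (s - n)" unfolding 2(2) .
      have "joined p (Cap h x y) (Cap h (n - 1) (s - n))"
        by (rule down[OF v]) (use 2 s s_def in linarith)+
      then have "joined p (Cap h x y) (rim_cap 0 s)" unfolding R .
      moreover have "\<not> n dvd s" using not_dvd_between(2)[of "s - n"] 2 s by simp
      ultimately show ?thesis
        using 2 p l by (intro joined_canon_bottom_rim[of s]) (simp_all add: down_label_def)
    next
      case 3
      have e: "3 * n - 1 - (s - n) = 4 * n - s - 1" by simp
      have "rim_cap m (4 * n - s - 1) = Cap m (s - n) (n - 1)"
        using rim_caps(3)[of "s - n" m] 3 s unfolding e by simp
      then have R: "rim_cap m (4 * n - s - 1) = Cap h (s - n) (n - 1)" unfolding 3(2) .
      have "joined p (Cap h x y) (Cap h (s - n) (n - 1))"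
        by (rule down[OF v]) (use 3 s s_def in linarith)+
      then have "joined p (Cap h x y) (rim_cap m (4 * n - s - 1))" unfolding R .
      moreover have "\<not> n dvd 4 * n - s" using not_dvd_between(3)[of "s - n"] 3 s by simp
      moreover have "even (4 * n - s + m) = p" using p 3 by simp
      ultimately show ?thesis
        using 3 l by (intro joined_canon_top_rim[of "4 * n - s"]) (simp_all add: down_label_def)
    next
      case 4
      have "rim_cap 0 (4 * n - s) = Cap 0 0 (s - 1)" using rim_caps(4)[of "s - 1" 0] 4 s by simp
      then have R: "rim_cap 0 (4 * n - s) = Cap h 0 (s - 1)" unfolding 4(2) .
      have "joined p (Cap h x y) (Cap h 0 (s - 1))"
        by (rule down[OF v]) (use 4 s n_pos s_def in linarith)+
      then have "joined p (Cap h x y) (rim_cap 0 (4 * n - s))" unfolding R .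
      moreover have "\<not> n dvd 4 * n - s" using not_dvd_between(4)[of s] 4 s by simp
      moreover have "even (4 * n - s) = p" using p 4 by simp
      ultimately show ?thesis
        using 4 l by (intro joined_canon_bottom_rim[of "4 * n - s"]) (simp_all add: down_label_def)
    next
      case 5
      have "rim_cap m (s - 1) = Cap m (s - 1) 0" using rim_caps(1)[of "s - 1" m] 5 s by simp
      then have R: "rim_cap m (s - 1) = Cap h (s - 1) 0" unfolding 5(2) .
      have "joined p (Cap h x y) (Cap h (s - 1) 0)"
        by (rule down[OF v]) (use 5 s n_pos s_def in linarith)+
      then have "joined p (Cap h x y) (rim_cap m (s - 1))" unfolding R .
      moreover have "\<not> n dvd s" using not_dvd_between(1)[of s] 5 s by simp
      moreover have "even (s + m) = p" using p 5 by simp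
      ultimately show ?thesis
        using 5 l by (intro joined_canon_top_rim[of s]) (simp_all add: down_label_def)
    qed
  qed
qed

text \<open>
  Linked squares have equal labels, and squares with equal labels are joined to the same standard square.
\<close>

theorem same_diagonal_iff:
  assumes a: "valid a" and b: "valid b"
  shows "(\<exists>D \<in> maximal_diagonals n n m. square_of a \<in> D \<and> square_of b \<in> D) \<longleftrightarrow> (\<exists>p. label p a = label p b)"
proof -
  have canon: "joined p c (canon (label p c))" if "valid c" for p c
    using that joined_canon_tube joined_canon_cap by (cases c) (simp_all only: valid.simps)
  have "square_of a \<in> squares n n m" using a in_squares_iff by blast
  then have "(\<exists>D \<in> maximal_diagonals n n m. square_of a \<in> D \<and> square_of b \<in> D) \<longleftrightarrow> (\<exists>p. joined p a b)"
    unfolding joined_def by (rule common_diagonal_iff)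
  moreover have "joined p a b \<longleftrightarrow> label p a = label p b" for p
  proof
    assume "joined p a b"
    then show "label p a = label p b" unfolding joined_def using linked_rtranclp_same_label a b by blast
  next
    assume "label p a = label p b"
    then show "joined p a b" using canon[OF a, of p] joined_sym[OF canon[OF b, of p]] joined_trans by simp
  qed
  ultimately show ?thesis by simp
qed

end

section \<open>Independent sets as matchings of labels\<close>

lemma indep_bishop_iff:
  assumes "S \<subseteq> squares a b c"
  shows "indep S (snd (bishop_graph a b c)) \<longleftrightarrow>
    (\<forall>s\<in>S. \<forall>t\<in>S. (\<exists>D \<in> maximal_diagonals a b c. s \<in> D \<and> t \<in> D) \<longrightarrow> s = t)"
proof -
  have edge: "{s, t} \<in> snd (bishop_graph a b c) \<longleftrightarrow> (\<exists>D \<in> maximal_diagonals a b c. s \<in> D \<and> t \<in> D)"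
    if "s \<in> S" "t \<in> S" "s \<noteq> t" for s t
    using that assms unfolding bishop_graph_def snd_conv by (auto simp: doubleton_eq_iff)
  show ?thesis
  proof (intro iffI ballI impI)
    fix s t assume *: "indep S (snd (bishop_graph a b c))" "s \<in> S" "t \<in> S"
      "\<exists>D \<in> maximal_diagonals a b c. s \<in> D \<and> t \<in> D"
    show "s = t"
    proof (rule ccontr)
      assume "s \<noteq> t"
      then have "{s, t} \<notin> snd (bishop_graph a b c)" using *(1)[unfolded indep_def, rule_format, OF *(2,3)] by blast
      then show False using edge[OF *(2,3) \<open>s \<noteq> t\<close>] *(4) by simp
    qed
  next
    assume *: "\<forall>s\<in>S. \<forall>t\<in>S. (\<exists>D \<in> maximal_diagonals a b c. s \<in> D \<and> t \<in> D) \<longrightarrow> s = t"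
    show "indep S (snd (bishop_graph a b c))"
      unfolding indep_def
    proof (intro ballI impI)
      fix s t assume st: "s \<in> S" "t \<in> S" "s \<noteq> t"
      then have "\<not> (\<exists>D \<in> maximal_diagonals a b c. s \<in> D \<and> t \<in> D)" using * by blast
      then show "{s, t} \<notin> snd (bishop_graph a b c)" using edge[OF st] by blast
    qed
  qed
qed

context prism
begin

text \<open>
  Non-attacking squares have distinct odd labels, which bounds their number. Conversely, squares whose labels
  are distinct for either parity do not attack each other.
\<close>

lemma independence_number_eqI:
  assumes L: "finite L" "\<And>a. valid a \<Longrightarrow> label False a \<in> L"
    and A: "\<And>a. a \<in> A \<Longrightarrow> valid a" "\<And>p. inj_on (label p) A" "card A = card L"
  shows "independence_number (bishop_graph n n m) = card L"
proof -
  let ?I = "{card S | S. S \<subseteq> squares n n m \<and> indep S (snd (bishop_graph n n m))}"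
  have upper: "card S \<le> card L" if S: "S \<subseteq> squares n n m" "indep S (snd (bishop_graph n n m))" for S
  proof -
    obtain f where f: "\<And>s. s \<in> S \<Longrightarrow> valid (f s) \<and> square_of (f s) = s"
    proof -
      have "\<forall>s\<in>S. \<exists>a. valid a \<and> square_of a = s" using S(1) in_squares_iff by blast
      then obtain f where "\<forall>s\<in>S. valid (f s) \<and> square_of (f s) = s" by (rule bchoice[THEN exE])
      then show thesis using that by blast
    qed
    have "inj_on (\<lambda>s. label False (f s)) S"
    proof (rule inj_onI)
      fix s t assume st: "s \<in> S" "t \<in> S" "label False (f s) = label False (f t)"
      then have "\<exists>D \<in> maximal_diagonals n n m. s \<in> D \<and> t \<in> D"
        using same_diagonal_iff[of "f s" "f t"] f by metis
      then show "s = t" using S(2) st unfolding indep_bishop_iff[OF S(1)] by blast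
    qed
    moreover have "(\<lambda>s. label False (f s)) ` S \<subseteq> L" using L(2) f by blast
    ultimately show ?thesis using L(1) by (rule card_inj_on_le)
  qed
  have sub: "square_of ` A \<subseteq> squares n n m" using A(1) in_squares_iff by blast
  have unique: "a = b" if ab: "a \<in> A" "b \<in> A" "\<exists>D \<in> maximal_diagonals n n m. square_of a \<in> D \<and> square_of b \<in> D" for a b
  proof -
    obtain p where "label p a = label p b" using same_diagonal_iff[of a b] A(1) ab by blast
    then show ?thesis using A(2)[of p] ab by (auto dest: inj_onD)
  qed
  have "inj_on square_of A"
  proof (rule inj_onI)
    fix a b assume ab: "a \<in> A" "b \<in> A" "square_of a = square_of b"
    have "label True a = label True b" using square_of_eq_label[of a b True] A(1) ab by blast
    then show "a = b" using A(2)[of True] ab by (auto dest: inj_onD)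
  qed
  then have "card (square_of ` A) = card L" using A(3) by (simp add: card_image)
  moreover have "indep (square_of ` A) (snd (bishop_graph n n m))"
    unfolding indep_bishop_iff[OF sub] using unique by blast
  ultimately have "card L \<in> ?I" using sub by (metis (mono_tags, lifting) mem_Collect_eq)
  moreover have "x \<le> card L" if "x \<in> ?I" for x using that upper by blast
  ultimately have "Max ?I = card L"
    by (intro Max_eqI) (auto intro: finite_subset[of _ "{..card L}"])
  then show ?thesis unfolding independence_number_def by (simp add: bishop_graph_def)
qed

text \<open>
  One representative for each diagonal of odd parity that comes down to the bottom.
\<close>

definition entries :: "int set" where
  "entries = {d. 0 \<le> d \<and> d < 4 * n \<and> odd d \<and> (separate (d mod n) \<or> d < 2 * n)}"

lemma finite_entries: "finite entries"
  by (rule finite_subset[of _ "{0..<4 * n}"]) (auto simp: entries_def)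

lemma separate_simps: "separate 0" "separate r" by (simp_all add: separate_def)

lemma mod_mod_n: "d mod (4 * n) mod n = d mod n" "d mod (2 * n) mod n = d mod n"
  by (simp_all add: mod_mod_cancel)

lemma entry_of_entries: "d \<in> entries \<Longrightarrow> entry d = Entry d"
  unfolding entries_def entry_def by auto

lemma entry_in_entries: "odd d \<Longrightarrow> entry d \<in> Entry ` entries"
proof -
  assume "odd d"
  have "d mod (4 * n) \<in> entries" if "separate (d mod n)"
    using that \<open>odd d\<close> n_pos by (simp add: entries_def mod_mod_n even_mod_4n)
  moreover have "d mod (2 * n) \<in> entries"
  proof -
    have "0 \<le> d mod (2 * n)" "d mod (2 * n) < 2 * n" using n_pos by simp_all
    moreover have "odd (d mod (2 * n))" using \<open>odd d\<close> by (simp add: dvd_mod_iff)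
    ultimately show ?thesis by (simp add: entries_def)
  qed
  ultimately show ?thesis unfolding entry_def by simp
qed

text \<open>
  The odd diagonals without an entry: main diagonals of the end faces and, for \<open>r = 0\<close>, those that
  rise from a corner of the bottom to a corner of the top.
\<close>

definition extras :: "diagonal_label set" where
  "extras = (if odd n then {Medial 0 1} else {}) \<union> (if odd m then {Medial m 0} else {})
     \<union> (if odd (n + m) then {Medial m 1} else {}) \<union> (if odd n \<and> r = 0 then {Rise n, Rise (3 * n)} else {})"

lemma rise_odd: "odd c \<Longrightarrow> rise c \<in> Entry ` entries \<union> extras"
proof -
  assume c: "odd c"
  show ?thesis
  proof (cases "n dvd c \<and> r = 0")
    case True
    then have "odd n" using c by (meson dvd_trans)
    define v where "v = c mod (4 * n)"
    have "n dvd v" using True by (simp add: v_def dvd_mod_iff)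
    moreover have "0 \<le> v" "v < 4 * n" using n_pos by (simp_all add: v_def)
    ultimately have "v = 0 \<or> v = n \<or> v = 2 * n \<or> v = 3 * n"
      by (rule corner_multiples)
    moreover have "odd v" using c by (simp add: v_def even_mod_4n)
    ultimately have "v = n \<or> v = 3 * n" by auto
    moreover have "rise c = Rise v" unfolding rise_def v_def if_P[OF conjunct1[OF True]] if_P[OF conjunct2[OF True]] ..
    moreover have "{Rise n, Rise (3 * n)} \<subseteq> extras"
      unfolding extras_def if_P[OF conjI[OF \<open>odd n\<close> conjunct2[OF True]]] by blast
    ultimately show ?thesis by auto
  next
    case False
    have "odd (c + 2 * n * (k + 1))" "odd (2 * n * (c div n) - c)" using c by simp_all
    then have "entry (c + 2 * n * (k + 1)) \<in> Entry ` entries" "entry (2 * n * (c div n) - c) \<in> Entry ` entries"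
      using entry_in_entries by blast+
    then show ?thesis unfolding rise_def using False by (auto simp only: if_True if_False split: if_split)
  qed
qed

lemma odd_labels: "valid a \<Longrightarrow> label False a \<in> Entry ` entries \<union> extras"
proof (cases a)
  case (Tube u z)
  show ?thesis
  proof (cases "even (u + z)")
    case True
    then have "odd (u + z + 1)" by simp
    then show ?thesis using entry_in_entries True unfolding Tube by simp
  next
    case False
    then have "odd (u - z)" by simp
    then show ?thesis using rise_odd False unfolding Tube by simp
  qed
next
  case (Cap h x y)
  assume "valid a"
  then have h: "h = 0 \<or> h = m" unfolding Cap by simp
  show ?thesis
  proof (cases "even (x + y + h)")
    case True
    then have par: "odd (x + y + 1 + h)" by simp
    have label: "label False a = down_label h (x + y + 1)" unfolding Cap using True by simp
    define i where "i = x + y + 1"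
    have o: "odd (i + h)" using par by (simp add: i_def)
    show ?thesis
    proof (cases "i = n")
      case True
      then show ?thesis using h o unfolding label i_def[symmetric] by (auto simp: down_label_def extras_def)
    next
      case False
      have "odd (if h = 0 then if n < i then i else 4 * n - i else m + (if n < i then 4 * n - i else i))"
        using h o by auto
      then show ?thesis using False entry_in_entries unfolding label i_def[symmetric] down_label_def by (auto split: if_splits)
    qed
  next
    case False
    then have label: "label False a = up_label h (x - y)" unfolding Cap by simp
    define i where "i = x - y"
    have o: "odd (i + h)" using False by (simp add: i_def)
    show ?thesis
    proof (cases "i = 0")
      case True
      then show ?thesis using h o unfolding label i_def[symmetric] by (auto simp: up_label_def extras_def)
    next
      case False
      have "odd (if h = 0 then if 0 < i then i else 2 * n - i else m + (if 0 < i then 2 * n - i else i))"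
        using h o by auto
      then show ?thesis using False entry_in_entries unfolding label i_def[symmetric] up_label_def by (auto split: if_splits)
    qed
  qed
qed

lemma entry_inj:
  assumes "entry d = entry d'"
  shows "2 * n dvd d - d'" "separate (d mod n) \<Longrightarrow> 4 * n dvd d - d'"
proof -
  let ?v = "\<lambda>d. if separate (d mod n) then d mod (4 * n) else d mod (2 * n)"
  have eq: "?v d = ?v d'" using assms unfolding entry_def by simp
  have v: "?v d mod (2 * n) = d mod (2 * n)" for d by (simp add: mod_mod_cancel)
  have *: "d mod (2 * n) = d' mod (2 * n)" using v[of d] v[of d'] eq by simp
  then show "2 * n dvd d - d'" by (simp add: mod_eq_dvd_iff)
  have **: "d mod n = d' mod n" using * mod_mod_n(2) by metis
  show "4 * n dvd d - d'" if "separate (d mod n)"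
  proof -
    have "separate (d' mod n)" using that unfolding ** .
    then have "d mod (4 * n) = d' mod (4 * n)" using eq that by simp
    then show ?thesis by (simp only: mod_eq_dvd_iff)
  qed
qed

text \<open>
  Within one residue class modulo \<open>n\<close>, passing to the mirror image in the previous corner preserves
  differences. So rising diagonals can be told apart by the starting position \<open>c\<close> just as falling
  ones by the entry, except that the entry of the diagonal has the residue of \<open>-c\<close>.
\<close>

lemma rise_inj:
  assumes "rise c = rise c'"
  shows "2 * n dvd c - c'" "separate (- c mod n) \<Longrightarrow> 4 * n dvd c - c'"
proof -
  have "2 * n dvd c - c' \<and> (separate (- c mod n) \<longrightarrow> 4 * n dvd c - c')"
  proof (cases "n dvd c"; cases "n dvd c'")
    assume 1: "n dvd c" and 2: "n dvd c'"
    have "4 * n dvd c - c'"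
    proof (cases "r = 0")
      case True
      have "Rise (c mod (4 * n)) = Rise (c' mod (4 * n))" using assms unfolding rise_def if_P[OF 1] if_P[OF 2] if_P[OF True] .
      then show ?thesis by (simp add: mod_eq_dvd_iff)
    next
      case False
      have "entry (c + 2 * n * (k + 1)) = entry (c' + 2 * n * (k + 1))" using assms unfolding rise_def if_P[OF 1] if_P[OF 2] if_not_P[OF False] .
      moreover have "n dvd c + 2 * n * (k + 1)" using 1 by simp
      then have "separate ((c + 2 * n * (k + 1)) mod n)" unfolding dvd_eq_mod_eq_0 using separate_simps by simp
      ultimately have "4 * n dvd c + 2 * n * (k + 1) - (c' + 2 * n * (k + 1))" by (rule entry_inj(2))
      then show ?thesis by simp
    qed
    moreover have "2 * n dvd 4 * n" by simp
    ultimately show ?thesis by (meson dvd_trans)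
  next
    assume 1: "n dvd c" and 2: "\<not> n dvd c'"
    have False
    proof (cases "r = 0")
      case True
      then show ?thesis using assms unfolding rise_def if_P[OF 1] if_not_P[OF 2] if_P[OF True] entry_def by simp
    next
      case False
      have "entry (c + 2 * n * (k + 1)) = entry (2 * n * (c' div n) - c')" using assms unfolding rise_def if_P[OF 1] if_not_P[OF 2] if_not_P[OF False] .
      then have "2 * n dvd c + 2 * n * (k + 1) - (2 * n * (c' div n) - c')" by (rule entry_inj(1))
      then have "n dvd c + 2 * n * (k + 1) - (2 * n * (c' div n) - c')" by (rule dvd_mult_right)
      moreover have "c + 2 * n * (k + 1) - (2 * n * (c' div n) - c') = (c + n * (2 * (k + 1) - 2 * (c' div n))) + c'" by (simp add: algebra_simps)
      ultimately have "n dvd (c + n * (2 * (k + 1) - 2 * (c' div n))) + c'" by simp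
      moreover have "n dvd c + n * (2 * (k + 1) - 2 * (c' div n))" using 1 by simp
      ultimately show ?thesis using 2 dvd_add_right_iff by blast
    qed
    then show ?thesis ..
  next
    assume 1: "\<not> n dvd c" and 2: "n dvd c'"
    have False
    proof (cases "r = 0")
      case True
      then show ?thesis using assms unfolding rise_def if_P[OF 2] if_not_P[OF 1] if_P[OF True] entry_def by simp
    next
      case False
      have "entry (c' + 2 * n * (k + 1)) = entry (2 * n * (c div n) - c)" using assms[symmetric] unfolding rise_def if_P[OF 2] if_not_P[OF 1] if_not_P[OF False] .
      then have "2 * n dvd c' + 2 * n * (k + 1) - (2 * n * (c div n) - c)" by (rule entry_inj(1))
      then have "n dvd c' + 2 * n * (k + 1) - (2 * n * (c div n) - c)" by (rule dvd_mult_right)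
      moreover have "c' + 2 * n * (k + 1) - (2 * n * (c div n) - c) = (c' + n * (2 * (k + 1) - 2 * (c div n))) + c" by (simp add: algebra_simps)
      ultimately have "n dvd (c' + n * (2 * (k + 1) - 2 * (c div n))) + c" by simp
      moreover have "n dvd c' + n * (2 * (k + 1) - 2 * (c div n))" using 2 by simp
      ultimately show ?thesis using 1 dvd_add_right_iff by blast
    qed
    then show ?thesis ..
  next
    assume 1: "\<not> n dvd c" and 2: "\<not> n dvd c'"
    define e e' where "e = 2 * n * (c div n) - c" "e' = 2 * n * (c' div n) - c'"
    have eq: "entry e = entry e'" using assms unfolding rise_def if_not_P[OF 1] if_not_P[OF 2] e_e'_def .
    have "n dvd e - e'" using entry_inj(1)[OF eq] by (rule dvd_mult_right)
    then have "n dvd n * (2 * (c div n) - 2 * (c' div n)) + (c' - c)" by (simp add: e_e'_def algebra_simps)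
    then have "n dvd c' - c" using dvd_add_right_iff[OF dvd_triv_left] by blast
    then have "c mod n = c' mod n" by (metis mod_eq_dvd_iff)
    moreover have "c = n * (c div n) + c mod n" "c' = n * (c' div n) + c' mod n" by simp_all
    ultimately have "c - c' = n * (c div n) - n * (c' div n)" by linarith
    then have diff: "e - e' = c - c'" by (simp add: e_e'_def algebra_simps)
    have "e mod n = - c mod n"
    proof -
      have "e = - c + n * (2 * (c div n))" by (simp add: e_e'_def)
      then show ?thesis by (simp only: mod_mult_self2)
    qed
    then show ?thesis using entry_inj[OF eq] unfolding diff by simp
  qed
  then show "2 * n dvd c - c'" "separate (- c mod n) \<Longrightarrow> 4 * n dvd c - c'" by blast+
qed

end

section \<open>The number of odd diagonals\<close>

lemma card_odd_between:
  fixes p q :: int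
  assumes "even p" "even q" "p \<le> q"
  shows "2 * int (card {a. p \<le> a \<and> a < q \<and> odd a}) = q - p"
proof -
  obtain i j where ij: "p = 2 * i" "q = 2 * j" using assms(1,2) by (auto elim!: evenE)
  have "{a. p \<le> a \<and> a < q \<and> odd a} = (\<lambda>t. 2 * t + 1) ` {i..<j}"
  proof (intro equalityI subsetI)
    fix a assume "a \<in> {a. p \<le> a \<and> a < q \<and> odd a}"
    then have a: "p \<le> a" "a < q" "odd a" by simp_all
    from a(3) obtain t where t: "a = 2 * t + 1" by (rule oddE)
    then have "t \<in> {i..<j}" using a ij by simp
    then show "a \<in> (\<lambda>t. 2 * t + 1) ` {i..<j}" using t by (rule rev_image_eqI)
  qed (auto simp: ij)
  then have "card {a. p \<le> a \<and> a < q \<and> odd a} = card {i..<j}"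
    by (simp add: card_image inj_on_def)
  then show ?thesis using assms(3) ij by simp
qed

context prism
begin

lemma finite_extras: "finite extras"
  by (simp add: extras_def)

lemma card_labels: "card (Entry ` entries \<union> extras) = card entries + card extras"
proof -
  have "card (Entry ` entries \<union> extras) = card (Entry ` entries) + card extras"
    by (intro card_Un_disjoint) (auto simp: finite_entries extras_def)
  then show ?thesis by (simp add: card_image inj_on_def)
qed

lemma card_extras_odd: "odd n \<Longrightarrow> card extras = (if r = 0 then 4 else 2)"
proof -
  assume n: "odd n"
  have m0: "m \<noteq> 0" and n0: "n \<noteq> 3 * n" using m_pos n_pos by simp_all
  show ?thesis
  proof (cases "r = 0")
    case True
    have "extras = {Medial 0 1, Medial m (if odd m then 0 else 1), Rise n, Rise (3 * n)}"
      unfolding extras_def if_P[OF n] if_P[OF conjI[OF n True]] using n by (cases "odd m") auto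
    then show ?thesis unfolding if_P[OF True] using m0 n0 by simp
  next
    case False
    have "extras = {Medial 0 1, Medial m (if odd m then 0 else 1)}"
      unfolding extras_def if_P[OF n] using False n by (cases "odd m") auto
    then show ?thesis using False m0 by simp
  qed
qed

lemma card_extras_even: "even n \<Longrightarrow> card extras = (if odd r then 2 else 0)"
proof -
  assume n: "even n"
  then have "odd m \<longleftrightarrow> odd r" "odd (n + m) \<longleftrightarrow> odd r" by (simp_all add: m_def)
  then have "extras = (if odd r then {Medial m 0, Medial m 1} else {})"
    unfolding extras_def using n by auto
  then show ?thesis by simp
qed

lemma card_separate: "int (card {a. 0 \<le> a \<and> a < n \<and> separate a}) = (if even k then r + 1 else if r = 0 then n else n - r + 1)"
proof (cases "even k")
  case True
  then have "{a. 0 \<le> a \<and> a < n \<and> separate a} = {0..r}" using r_ge r_less by (auto simp: separate_def)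
  then show ?thesis using True r_ge by simp
next
  case False
  then have *: "{a. 0 \<le> a \<and> a < n \<and> separate a} = insert 0 {r..<n}" using r_ge r_less by (auto simp: separate_def)
  show ?thesis
  proof (cases "r = 0")
    case True
    then have "insert 0 {r..<n} = {0..<n}" using n_pos by auto
    then show ?thesis using * False True n_pos by simp
  next
    case r0: False
    then have "card (insert 0 {r..<n}) = Suc (card {r..<n})" using r_ge by simp
    then show ?thesis using * False r0 r_less by simp
  qed
qed

lemma card_odd_separate:
  assumes "even n"
  shows "2 * int (card {a. 0 \<le> a \<and> a < n \<and> odd a \<and> separate a})
    = (if even k then r else n - r) + (if odd r then 1 else 0)"
proof -
  \<comment> \<open>The ends of the interval are moved to even numbers, between which half of the numbers are odd.\<close>
  define lo hi where "lo = (if even k then 0 else if odd r then r - 1 else r)"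
    and "hi = (if even k then if odd r then r + 1 else r else n)"
  have "{a. 0 \<le> a \<and> a < n \<and> odd a \<and> separate a} = {a. lo \<le> a \<and> a < hi \<and> odd a}"
  proof (intro Collect_cong iffI)
    fix a assume a: "0 \<le> a \<and> a < n \<and> odd a \<and> separate a"
    then have "a \<noteq> 0" "odd a" by auto
    then show "lo \<le> a \<and> a < hi \<and> odd a" using a by (auto simp: lo_def hi_def separate_def split: if_splits)
  next
    fix a assume a: "lo \<le> a \<and> a < hi \<and> odd a"
    have "odd r \<Longrightarrow> r - 1 \<le> a \<Longrightarrow> r \<le> a" using a by (cases "a = r - 1") auto
    moreover have "even r \<Longrightarrow> a \<noteq> r" using a by auto
    moreover have "odd r \<Longrightarrow> r + 1 \<le> n" using r_less by simp
    ultimately show "0 \<le> a \<and> a < n \<and> odd a \<and> separate a"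
      using a r_ge r_less by (auto simp: lo_def hi_def separate_def split: if_splits)
  qed
  moreover have "2 * int (card {a. lo \<le> a \<and> a < hi \<and> odd a}) = hi - lo"
    by (rule card_odd_between) (use assms r_ge r_less in \<open>auto simp: lo_def hi_def\<close>)
  ultimately show ?thesis by (auto simp: lo_def hi_def)
qed

lemma card_entries_split:
  "int (card entries) = n + int (card {d. 2 * n \<le> d \<and> d < 4 * n \<and> odd d \<and> separate (d mod n)})"
proof -
  let ?A = "{d. 0 \<le> d \<and> d < 2 * n \<and> odd d}" and ?B = "{d. 2 * n \<le> d \<and> d < 4 * n \<and> odd d \<and> separate (d mod n)}"
  have fin: "finite ?A" "finite ?B"
    by (rule finite_subset[of _ "{0..<4 * n}"], use n_pos in auto)+
  have "entries = ?A \<union> ?B" using n_pos by (auto simp: entries_def)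
  moreover have "card (?A \<union> ?B) = card ?A + card ?B" by (rule card_Un_disjoint[OF fin]) auto
  moreover have "2 * int (card ?A) = 2 * n" using card_odd_between[of 0 "2 * n"] n_pos by simp
  ultimately show ?thesis by simp
qed

text \<open>
  In the upper half of the perimeter only separate residues count. The third and the fourth face start at
  \<open>2n\<close> and at \<open>3n\<close>, so for odd \<open>n\<close> the parities of the residues are
  opposite on them.
\<close>

lemma upper_half_blocks:
  "{d. 2 * n \<le> d \<and> d < 4 * n \<and> odd d \<and> separate (d mod n)}
    = (\<lambda>a. 2 * n + a) ` {a. 0 \<le> a \<and> a < n \<and> odd a \<and> separate a}
      \<union> (\<lambda>a. 3 * n + a) ` {a. 0 \<le> a \<and> a < n \<and> odd (n + a) \<and> separate a}" (is "?L = ?R")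
proof (intro equalityI subsetI)
  fix d assume d: "d \<in> ?L"
  have "d mod n = d - 2 * n \<and> d < 3 * n \<or> d mod n = d - 3 * n \<and> 3 * n \<le> d"
    using d block_unique(2)[of d 2 "d - 2 * n"] block_unique(2)[of d 3 "d - 3 * n"]
    by (cases "d < 3 * n") simp_all
  then show "d \<in> ?R"
  proof
    assume *: "d mod n = d - 2 * n \<and> d < 3 * n"
    then have "d - 2 * n \<in> {a. 0 \<le> a \<and> a < n \<and> odd a \<and> separate a}" using d by simp
    moreover have "d = 2 * n + (d - 2 * n)" by simp
    ultimately show ?thesis by blast
  next
    assume *: "d mod n = d - 3 * n \<and> 3 * n \<le> d"
    then have "d - 3 * n \<in> {a. 0 \<le> a \<and> a < n \<and> odd (n + a) \<and> separate a}" using d by simp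
    moreover have "d = 3 * n + (d - 3 * n)" by simp
    ultimately show ?thesis by blast
  qed
next
  fix d assume "d \<in> ?R"
  then consider a where "d = 2 * n + a" "0 \<le> a" "a < n" "odd a" "separate a"
    | a where "d = 3 * n + a" "0 \<le> a" "a < n" "odd (n + a)" "separate a" by blast
  then show "d \<in> ?L"
  proof cases
    case (1 a)
    then show ?thesis using block_unique(2)[OF 1(1-3)] by simp
  next
    case (2 a)
    then show ?thesis using block_unique(2)[OF 2(1-3)] by simp
  qed
qed

lemma card_entries:
  "int (card entries) = n + (if odd n then if even k then r + 1 else if r = 0 then n else n - r + 1
     else (if even k then r else n - r) + (if odd r then 1 else 0))"
proof -
  let ?P = "{a. 0 \<le> a \<and> a < n \<and> odd a \<and> separate a}" and ?Q = "{a. 0 \<le> a \<and> a < n \<and> odd (n + a) \<and> separate a}"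
  have fin: "finite ?P" "finite ?Q" by (rule finite_subset[of _ "{0..<n}"], auto)+
  have "card ((\<lambda>a. 2 * n + a) ` ?P \<union> (\<lambda>a. 3 * n + a) ` ?Q) = card ?P + card ?Q"
    by (subst card_Un_disjoint) (use fin in \<open>auto simp: card_image\<close>)
  then have c: "int (card entries) = n + int (card ?P + card ?Q)"
    unfolding card_entries_split upper_half_blocks by simp
  show ?thesis
  proof (cases "odd n")
    case True
    have "card ?P + card ?Q = card (?P \<union> ?Q)" by (rule card_Un_disjoint[symmetric]) (use fin True in auto)
    also have "?P \<union> ?Q = {a. 0 \<le> a \<and> a < n \<and> separate a}" using True by auto
    finally show ?thesis using c card_separate True by simp
  next
    case False
    then have "?Q = ?P" by auto
    then show ?thesis using c card_odd_separate False by simp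
  qed
qed

section \<open>Independent sets of maximal size\<close>

text \<open>
  The square in the row at height \<open>w div 2\<close> from which a path comes down to the bottom at position
  \<open>d\<close>. For odd \<open>w\<close>, the other diagonal of this square comes up from
  \<open>d - w\<close>.
\<close>

definition row :: "int \<Rightarrow> int \<Rightarrow> coord" where
  "row w d = Tube (d - 1 - w div 2) (w div 2)"

lemma row_inj: "inj_on (row w) D"
  by (rule inj_onI) (simp add: row_def)

lemma valid_row: "0 \<le> w \<Longrightarrow> w < 2 * n \<Longrightarrow> valid (row w d)"
  using m_ge by (auto simp: row_def)

lemma label_row:
  assumes "odd w"
  shows "odd d \<Longrightarrow> label False (row w d) = entry d" "odd d \<Longrightarrow> label True (row w d) = rise (d - w)"
    "even d \<Longrightarrow> label False (row w d) = rise (d - w)" "even d \<Longrightarrow> label True (row w d) = entry d"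
proof -
  obtain i where i: "w = 2 * i + 1" using assms by (rule oddE)
  then have z: "w div 2 = i" by simp
  have "d - 1 - i + i + 1 = d" "d - 1 - i - i = d - w" using i by simp_all
  moreover have "even (d - 1 - i + i) \<longleftrightarrow> odd d" by simp
  ultimately show "odd d \<Longrightarrow> label False (row w d) = entry d" "odd d \<Longrightarrow> label True (row w d) = rise (d - w)"
    "even d \<Longrightarrow> label False (row w d) = rise (d - w)" "even d \<Longrightarrow> label True (row w d) = entry d"
    unfolding row_def z label.simps by (simp_all only: if_True if_False simp_thms)
qed

lemma entries_unique:
  assumes "d \<in> entries" "d' \<in> entries" "2 * n dvd d - d'" "separate (d mod n) \<Longrightarrow> 4 * n dvd d - d'"
  shows "d = d'"
proof (rule ccontr)
  assume ne: "d \<noteq> d'"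
  have b: "0 \<le> d" "d < 4 * n" "0 \<le> d'" "d' < 4 * n" using assms(1,2) by (simp_all add: entries_def)
  show False
  proof (cases "separate (d mod n)")
    case True
    have "\<bar>d - d'\<bar> < 4 * n" using b by linarith
    then show ?thesis using not_dvd_small[of "d - d'"] assms(4)[OF True] ne by simp
  next
    case False
    have "n dvd d - d'" using assms(3) by (rule dvd_mult_right)
    then have "d mod n = d' mod n" by (simp add: mod_eq_dvd_iff)
    then have "d < 2 * n" "d' < 2 * n" using False assms(1,2) by (auto simp: entries_def)
    then have "\<bar>d - d'\<bar> < 2 * n" using b by linarith
    then show ?thesis using dvd_imp_le_int[of "d - d'" "2 * n"] assms(3) ne n_pos by simp
  qed
qed

text \<open>
  The odd labels are distinct because \<open>d\<close> itself is the label. For the even labels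
  \<open>rise (d - w)\<close>, injectivity modulo \<open>4n\<close> is needed where the entries are taken modulo
  \<open>4n\<close>; there the residue \<open>w - d\<close> has to be separate, too.
\<close>

lemma inj_label_row:
  assumes w: "odd w" and D: "D \<subseteq> entries"
    and s: "\<And>d. odd d \<Longrightarrow> separate (d mod n) \<Longrightarrow> separate ((w - d) mod n)"
  shows "inj_on (label p) (row w ` D)"
proof -
  have odd: "odd d" if "d \<in> D" for d using that D by (auto simp: entries_def)
  have "inj_on (\<lambda>d. label p (row w d)) D"
  proof (rule inj_onI)
    fix d d' assume dd: "d \<in> D" "d' \<in> D" and eq: "label p (row w d) = label p (row w d')"
    show "d = d'"
    proof (cases p)
      case True
      then have rise: "rise (d - w) = rise (d' - w)" using eq label_row(2)[OF w] odd dd by simp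
      show ?thesis
      proof (rule entries_unique)
        show "d \<in> entries" "d' \<in> entries" using dd D by blast+
        show "2 * n dvd d - d'" using rise_inj(1)[OF rise] by simp
        have "- (d - w) = w - d" by simp
        then show "4 * n dvd d - d'" if "separate (d mod n)"
          using rise_inj(2)[OF rise] s[OF odd[OF dd(1)] that] by simp
      qed
    next
      case False
      then have "entry d = entry d'" using eq label_row(1)[OF w] odd dd by simp
      then show ?thesis using entry_of_entries dd D by (metis diagonal_label.inject(1) subsetD)
    qed
  qed
  then show ?thesis by (intro inj_on_imageI) (simp add: comp_def)
qed

lemma inj_on_UnI: "inj_on f A \<Longrightarrow> inj_on f B \<Longrightarrow> f ` A \<inter> f ` B = {} \<Longrightarrow> inj_on f (A \<union> B)"
  by (auto simp: inj_on_Un)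

text \<open>
  The separate residues are \<open>0\<close>, \<open>r\<close> and one of the two intervals between them, a set
  that is symmetric under \<open>a \<mapsto> r - a\<close> modulo \<open>n\<close>.
\<close>

lemma separate_reflect:
  assumes "separate (d mod n)" "(w - r) mod n = 0"
  shows "separate ((w - d) mod n)"
proof -
  have "n dvd w - r" using assms(2) by (simp add: dvd_eq_mod_eq_0)
  then have "(w - d) mod n = (r - d) mod n" by (simp add: mod_eq_dvd_iff)
  also have "\<dots> = (r - d mod n) mod n" by (simp add: mod_diff_right_eq)
  finally have eq: "(w - d) mod n = (r - d mod n) mod n" .
  define a where "a = d mod n"
  have a: "0 \<le> a" "a < n" using n_pos by (simp_all add: a_def)
  have "(r - a) mod n = (if a \<le> r then r - a else n + r - a)"
    using a r_ge r_less block_unique(2)[of "r - a" 0 "r - a"] block_unique(2)[of "r - a" "-1" "n + r - a"] by auto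
  then show ?thesis
    using assms(1) a r_ge r_less unfolding eq a_def[symmetric] by (auto simp: separate_def split: if_splits)
qed

text \<open>
  For even \<open>n\<close> and \<open>r\<close>, an odd separate residue is not \<open>0\<close> or
  \<open>r\<close>, so reflecting it in \<open>(r + 1)/2\<close> instead of \<open>r/2\<close> leads at most to
  an end point of the same interval.
\<close>

lemma separate_reflect_even:
  assumes "even n" "even r" "odd d" "separate (d mod n)"
  shows "separate ((r + 1 - d) mod n)"
proof -
  have eq: "(r + 1 - d) mod n = (r + 1 - d mod n) mod n" by (simp add: mod_diff_right_eq)
  define a where "a = d mod n"
  have a: "0 \<le> a" "a < n" using n_pos by (simp_all add: a_def)
  have oa: "odd a" using assms(1,3) by (simp add: a_def dvd_mod_iff)
  then have ne: "a \<noteq> r" "a \<noteq> 0" using assms(2) by auto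
  show ?thesis
  proof (cases "even k")
    case True
    then have "a < r" "1 \<le> a" using assms(4) ne a unfolding a_def[symmetric] by (auto simp: separate_def)
    then have "(r + 1 - a) mod n = r + 1 - a" using block_unique(2)[of "r + 1 - a" 0 "r + 1 - a"] r_less by simp
    then show ?thesis using \<open>a < r\<close> \<open>1 \<le> a\<close> True unfolding eq a_def[symmetric] by (auto simp: separate_def)
  next
    case False
    then have ra: "r < a" using assms(4) ne a unfolding a_def[symmetric] by (auto simp: separate_def)
    show ?thesis
    proof (cases "a = r + 1")
      case True
      then show ?thesis unfolding eq a_def[symmetric] by (simp add: separate_simps)
    next
      case ne': False
      then have "(r + 1 - a) mod n = n + r + 1 - a"
        using block_unique(2)[of "r + 1 - a" "-1" "n + r + 1 - a"] ra a r_ge by simp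
      then show ?thesis using a False unfolding eq a_def[symmetric] by (auto simp: separate_def)
    qed
  qed
qed

text \<open>
  All corners are even, so every odd diagonal is closed and comes down to the bottom, and the row alone gives
  enough squares.
\<close>

lemma independence_even_even:
  assumes "even n" "even r"
  shows "int (independence_number (bishop_graph n n m)) = int (card entries)"
proof -
  have ex: "extras = {}" using card_extras_even assms finite_extras by auto
  have w: "odd (r + 1)" using assms by simp
  have v: "0 \<le> r + 1" "r + 1 < 2 * n" using r_ge r_less by simp_all
  have "independence_number (bishop_graph n n m) = card (Entry ` entries \<union> extras)"
  proof (rule independence_number_eqI[of _ "row (r + 1) ` entries"])
    show "inj_on (label p) (row (r + 1) ` entries)" for p
      by (rule inj_label_row[OF w order_refl]) (rule separate_reflect_even[OF assms])
    show "card (row (r + 1) ` entries) = card (Entry ` entries \<union> extras)"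
      unfolding card_labels by (simp add: ex card_image row_inj)
  qed (use odd_labels finite_entries finite_extras valid_row[OF v] in auto)
  then show ?thesis unfolding card_labels by (simp add: ex)
qed

lemma rise_range: "rise c \<in> range Entry \<union> range Rise"
  by (simp add: rise_def entry_def)

lemma label_row_range:
  assumes "odd w"
  shows "label p (row w d) \<in> range Entry \<union> range Rise"
  using label_row[OF assms, of d] rise_range by (cases p; cases "odd d") (simp_all add: entry_def)

lemma rise_neq_entry:
  assumes "r = 0" "n dvd e"
  shows "rise c \<noteq> entry e"
proof
  assume eq: "rise c = entry e"
  show False
  proof (cases "n dvd c")
    case True
    show False using eq unfolding rise_def if_P[OF True] if_P[OF assms(1)] entry_def by simp
  next
    case False
    have "entry (2 * n * (c div n) - c) = entry e" using eq unfolding rise_def if_not_P[OF False] .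
    then have "2 * n dvd 2 * n * (c div n) - c - e" by (rule entry_inj(1))
    then have "n dvd 2 * n * (c div n) - c - e" by (rule dvd_mult_right)
    then have "n dvd n * (2 * (c div n)) - (c + e)" by (simp add: algebra_simps)
    then have "n dvd c + e" using dvd_diff_right_iff[OF dvd_triv_left] by blast
    then show False using False assms(2) dvd_add_left_iff by blast
  qed
qed

text \<open>
  Since \<open>n\<close> is odd, \<open>w\<close> can be chosen odd and congruent to \<open>r\<close> modulo
  \<open>n\<close>. On each end face the two main diagonals have different parities, and its central square
  matches them. For \<open>r = 0\<close> two more squares of the row match the odd diagonals rising from a
  corner with the even ones coming down to a corner.
\<close>

lemma independence_odd:
  assumes "odd n"
  shows "int (independence_number (bishop_graph n n m)) = int (card entries) + (if r = 0 then 4 else 2)"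
proof -
  \<comment> \<open>The odd number between \<open>0\<close> and \<open>2n\<close> that is congruent to \<open>r\<close> modulo \<open>n\<close>.\<close>
  define w where "w = (if odd r then r else n + r)"
  have w: "odd w" "0 \<le> w" "w < 2 * n" "(w - r) mod n = 0"
    using assms r_ge r_less by (auto simp: w_def)
  define c where "c = n div 2"
  have c: "n = 2 * c + 1" using assms by (simp add: c_def)
  have m0: "m \<noteq> 0" using m_pos by simp
  let ?R = "row w ` entries" and ?C = "{Cap 0 c c, Cap m c c}"
    and ?D = "if r = 0 then {row w 0, row w (2 * n)} else {}"
  have centre: "label p (Cap h c c) \<in> {Medial h 0, Medial h 1}" for p h
  proof (cases "even (c + c + h) = p")
    case True
    then have "label p (Cap h c c) = up_label h 0" by (rule label_cap_up) simp
    then show ?thesis by (simp add: up_label_def)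
  next
    case False
    then have "even (c + c + h) = (\<not> p)" by blast
    moreover have "c + c + 1 = n" using c by simp
    ultimately have "label p (Cap h c c) = down_label h n" by (rule label_cap_down)
    then show ?thesis by (simp add: down_label_def)
  qed
  have inj: "inj_on (label p) (?R \<union> ?D \<union> ?C)" for p
  proof (intro inj_on_UnI)
    show "inj_on (label p) ?R"
      by (rule inj_label_row[OF w(1) order_refl]) (rule separate_reflect[OF _ w(4)])
    show "inj_on (label p) ?C" using centre[of p 0] centre[of p m] m0 by (auto simp: inj_on_def simp del: label.simps)
    show "label p ` (?R \<union> ?D) \<inter> label p ` ?C = {}"
    proof -
      have "label p ` (?R \<union> ?D) \<subseteq> range Entry \<union> range Rise" using label_row_range[OF w(1)] by auto
      moreover have "label p ` ?C \<inter> (range Entry \<union> range Rise) = {}"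
        using centre[of p 0] centre[of p m] by (auto simp del: label.simps)
      ultimately show ?thesis by blast
    qed
    show "inj_on (label p) ?D" "label p ` ?R \<inter> label p ` ?D = {}"
    proof -
      have "inj_on (label p) ?D \<and> label p ` ?R \<inter> label p ` ?D = {}" if r0: "r = 0"
      proof (cases p)
        case True
        have e: "entry 0 = Entry 0" "entry (2 * n) = Entry (2 * n)" using separate_simps(1) n_pos by (simp_all add: entry_def)
        have l: "label p (row w 0) = entry 0" "label p (row w (2 * n)) = entry (2 * n)"
          using label_row(4)[OF w(1)] True by simp_all
        have "label p (row w d) \<notin> {entry 0, entry (2 * n)}" if "d \<in> entries" for d
        proof -
          have "odd d" using that by (simp add: entries_def)
          then have "label p (row w d) = rise (d - w)" using label_row(2)[OF w(1)] True by simp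
          then show ?thesis using rise_neq_entry[OF r0] by simp
        qed
        then have "label p ` ?R \<inter> {entry 0, entry (2 * n)} = {}" by blast
        moreover have "label p ` {row w 0, row w (2 * n)} = {entry 0, entry (2 * n)}" using l by simp
        moreover have "inj_on (label p) {row w 0, row w (2 * n)}"
          using l e n_pos unfolding inj_on_def by auto
        ultimately show ?thesis unfolding if_P[OF r0] by (simp only: simp_thms)
      next
        case False
        have wn: "w = n" unfolding w_def r0 by simp
        have rise: "rise (- n) = Rise (3 * n)" "rise n = Rise n"
        proof -
          have "- n mod (4 * n) = (3 * n) mod (4 * n)" unfolding mod_eq_dvd_iff by simp
          also have "(3 * n) mod (4 * n) = 3 * n" using n_pos by (intro mod_pos_pos_trivial) simp_all
          finally have "- n mod (4 * n) = 3 * n" .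
          moreover have "n mod (4 * n) = n" using n_pos by (intro mod_pos_pos_trivial) simp_all
          moreover have "n dvd n" "n dvd - n" by simp_all
          ultimately show "rise (- n) = Rise (3 * n)" "rise n = Rise n"
            unfolding rise_def if_P[OF r0] by simp_all
        qed
        have "label p (row w 0) = rise (- n)" "label p (row w (2 * n)) = rise n"
          using label_row(3)[OF w(1)] False wn by simp_all
        then have l: "label p (row w 0) = Rise (3 * n)" "label p (row w (2 * n)) = Rise n"
          unfolding rise by blast+
        have "label p (row w d) \<in> range Entry" if "d \<in> entries" for d
        proof -
          have "odd d" using that by (simp add: entries_def)
          then have "label p (row w d) = entry d" using label_row(1)[OF w(1)] False by simp
          then show ?thesis by (simp add: entry_def)
        qed
        then have "label p ` ?R \<subseteq> range Entry" by blast
        moreover have "n \<noteq> 3 * n" using n_pos by simp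
        ultimately show ?thesis unfolding if_P[OF r0] using l by (auto simp: inj_on_def)
      qed
      then show "inj_on (label p) ?D" "label p ` ?R \<inter> label p ` ?D = {}" by (cases "r = 0"; simp)+
    qed
  qed
  have card: "card (?R \<union> ?D \<union> ?C) = card entries + (if r = 0 then 4 else 2)"
  proof -
    have 1: "finite ?R" "finite ?D" "finite ?C" using finite_entries by simp_all
    have "(?R \<union> ?D) \<inter> ?C = {}" by (auto simp: row_def)
    moreover have "?R \<inter> ?D = {}"
    proof -
      have "row w d = row w d' \<Longrightarrow> d = d'" for d d' by (simp add: row_def)
      moreover have "0 \<notin> entries" "2 * n \<notin> entries" by (simp_all add: entries_def)
      ultimately have "?R \<inter> {row w 0, row w (2 * n)} = {}" by blast
      moreover have "?D \<subseteq> {row w 0, row w (2 * n)}" by simp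
      ultimately show ?thesis by blast
    qed
    ultimately have "card (?R \<union> ?D \<union> ?C) = card ?R + card ?D + card ?C"
      using 1 by (simp only: card_Un_disjoint finite_Un)
    moreover have "card ?R = card entries" by (rule card_image[OF row_inj])
    moreover have "card ?D = (if r = 0 then 2 else 0)" using n_pos by (simp add: row_def)
    moreover have "card ?C = 2" using m0 by simp
    ultimately show ?thesis by simp
  qed
  have "independence_number (bishop_graph n n m) = card (Entry ` entries \<union> extras)"
  proof (rule independence_number_eqI[of _ "?R \<union> ?D \<union> ?C"])
    show "finite (Entry ` entries \<union> extras)" using finite_entries finite_extras by simp
    show "label False a \<in> Entry ` entries \<union> extras" if "valid a" for a using odd_labels that .
    show "valid a" if "a \<in> ?R \<union> ?D \<union> ?C" for a
    proof -
      have "0 \<le> c" "c < n" using c n_pos by linarith+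
      then have "valid (Cap 0 c c)" "valid (Cap m c c)" by simp_all
      moreover have "?D \<subseteq> {row w 0, row w (2 * n)}" by simp
      then have "a \<in> range (row w) \<or> a \<in> ?C" using that by blast
      ultimately show ?thesis using valid_row[OF w(2,3)] by blast
    qed
    show "inj_on (label p) (?R \<union> ?D \<union> ?C)" for p by (rule inj)
    show "card (?R \<union> ?D \<union> ?C) = card (Entry ` entries \<union> extras)"
      unfolding card card_labels card_extras_odd[OF assms] ..
  qed
  then show ?thesis unfolding card_labels card_extras_odd[OF assms] by simp
qed

text \<open>
  Here the two main diagonals of the bottom are even and those of the top are odd, so no square matches two main
  diagonals. Two squares of the row, with the entries \<open>r\<close> and \<open>n + r\<close>, are given up:
  their odd diagonals are matched with the main diagonals of the bottom instead, and their even diagonals, which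
  rise from the corners \<open>0\<close> and \<open>n\<close>, with those of the top.
\<close>

lemma independence_even_odd:
  assumes n: "even n" and r: "odd r"
  shows "int (independence_number (bishop_graph n n m)) = int (card entries) + 2"
proof -
  have r0: "0 < r" using r r_ge by (cases "r = 0") auto
  have om: "odd m" using n r by (simp add: m_def)
  have m0: "m \<noteq> 0" using m_pos by simp
  obtain t where t: "r = 2 * t + 1" using r by (rule oddE)
  obtain q where q: "n = 2 * q" using n by (rule evenE)
  define i j where "i = q + t" and "j = q - 1 - t"
  have ij: "i - j = r" "i + j + 1 = n" "i + i + 1 = n + r" "j + j + 1 = n - r" "0 \<le> i" "i < n" "0 \<le> j" "j < n"
    using t q r_ge r_less by (auto simp: i_def j_def)
  have par: "odd (i + j)" "odd (j + i)" using ij(2) n by presburger+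
  \<comment> \<open>Each lies on a main diagonal of the bottom; the other diagonal comes down at \<open>r\<close> or at \<open>n + r\<close>.\<close>
  let ?b1 = "Cap 0 i j" and ?b2 = "Cap 0 i i"
  have entr: "r \<in> entries" "n + r \<in> entries"
  proof -
    have "r mod n = r" "(n + r) mod n = r" using r_ge r_less by simp_all
    then show "r \<in> entries" "n + r \<in> entries" using r n r_ge r_less separate_simps(2) by (simp_all add: entries_def)
  qed
  have label_b: "label False ?b1 = Entry r" "label False ?b2 = Entry (n + r)" "label True ?b1 = Medial 0 1" "label True ?b2 = Medial 0 0"
  proof -
    have "up_label 0 r = Entry r" using r0 entry_of_entries[OF entr(1)] by (simp add: up_label_def)
    then show "label False ?b1 = Entry r" using label_cap_up[of i j 0 False r] par ij(1) by simp
    have "down_label 0 (n + r) = Entry (n + r)" using r0 entry_of_entries[OF entr(2)] by (simp add: down_label_def)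
    then show "label False ?b2 = Entry (n + r)" using label_cap_down[of i i 0 False "n + r"] ij(3) by simp
    show "label True ?b1 = Medial 0 1" using label_cap_down[of i j 0 True n] par ij(2) by (simp add: down_label_def)
    show "label True ?b2 = Medial 0 0" using label_cap_up[of i i 0 True 0] by (simp add: up_label_def)
  qed
  have label_t: "label False (Cap m i j) = Medial m 1" "label False (Cap m j i) = Medial m 1"
    "label False (Cap m i i) = Medial m 0" "label False (Cap m j j) = Medial m 0"
    "label True (Cap m i j) = entry ((k + 2) * n)" "label True (Cap m j i) = entry (k * n)"
    "label True (Cap m i i) = entry ((k + 3) * n)" "label True (Cap m j j) = entry ((k + 1) * n)"
  proof -
    have e: "even (i + j + m)" "even (j + i + m)" "odd (i + i + m)" "odd (j + j + m)" using par om by simp_all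
    have d: "down_label m n = Medial m 1" "up_label m 0 = Medial m 0" by (simp_all add: down_label_def up_label_def)
    show "label False (Cap m i j) = Medial m 1" using label_cap_down[of i j m False n] e ij(2) d by simp
    show "label False (Cap m j i) = Medial m 1" using label_cap_down[of j i m False n] e ij(2) d by simp
    show "label False (Cap m i i) = Medial m 0" using label_cap_up[of i i m False 0] e d by simp
    show "label False (Cap m j j) = Medial m 0" using label_cap_up[of j j m False 0] e d by simp
    have "m + (2 * n - r) = (k + 2) * n" "m + - r = k * n" "m + (4 * n - (n + r)) = (k + 3) * n" "m + (n - r) = (k + 1) * n"
      by (simp_all add: m_def algebra_simps)
    then have v: "up_label m r = entry ((k + 2) * n)" "up_label m (- r) = entry (k * n)"
      "down_label m (n + r) = entry ((k + 3) * n)" "down_label m (n - r) = entry ((k + 1) * n)"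
      unfolding up_label_def down_label_def using r0 m0 by simp_all
    show "label True (Cap m i j) = entry ((k + 2) * n)" using label_cap_up[of i j m True r] e ij(1) v by simp
    show "label True (Cap m j i) = entry (k * n)" using label_cap_up[of j i m True "- r"] e ij(1) v by simp
    show "label True (Cap m i i) = entry ((k + 3) * n)" using label_cap_down[of i i m True "n + r"] e ij(3) v by simp
    show "label True (Cap m j j) = entry ((k + 1) * n)" using label_cap_down[of j j m True "n - r"] e ij(4) v by simp
  qed
  have rise_cor: "rise 0 = entry ((2 * k + 2) * n)" "rise n = entry ((2 * k + 3) * n)"
    using r0 by (simp_all add: rise_def algebra_simps)
  have four: "entry (x * n) = entry (y * n)" if "4 dvd x - y" for x y
  proof -
    obtain z where "x - y = 4 * z" using \<open>4 dvd x - y\<close> by (rule dvdE)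
    then have "x = y + 4 * z" by simp
    then have "x * n = y * n + 4 * n * z" by (simp add: algebra_simps)
    then show ?thesis using entry_4n by simp
  qed
  \<comment> \<open>Where the diagonals rising from two adjacent corners reach the top depends on \<open>k\<close> modulo \<open>4\<close>.\<close>
  obtain t1 t2 where t1: "t1 = Cap m i j \<or> t1 = Cap m j i" and t2: "t2 = Cap m i i \<or> t2 = Cap m j j"
    and freed: "{label True t1, label True t2} = {rise 0, rise n}"
  proof -
    have "k mod 4 = 0 \<or> k mod 4 = 1 \<or> k mod 4 = 2 \<or> k mod 4 = 3" by presburger
    then show thesis
    proof (elim disjE)
      assume "k mod 4 = 0"
      then have "4 dvd (k + 2) - (2 * k + 2)" "4 dvd (k + 3) - (2 * k + 3)" by presburger+
      then show thesis using that[of "Cap m i j" "Cap m i i"] four label_t(5,7) rise_cor by metis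
    next
      assume "k mod 4 = 1"
      then have "4 dvd k - (2 * k + 3)" "4 dvd (k + 3) - (2 * k + 2)" by presburger+
      then show thesis using that[of "Cap m j i" "Cap m i i"] four label_t(6,7) rise_cor by (metis insert_commute)
    next
      assume "k mod 4 = 2"
      then have "4 dvd k - (2 * k + 2)" "4 dvd (k + 1) - (2 * k + 3)" by presburger+
      then show thesis using that[of "Cap m j i" "Cap m j j"] four label_t(6,8) rise_cor by metis
    next
      assume "k mod 4 = 3"
      then have "4 dvd (k + 2) - (2 * k + 3)" "4 dvd (k + 1) - (2 * k + 2)" by presburger+
      then show thesis using that[of "Cap m i j" "Cap m j j"] four label_t(5,8) rise_cor by (metis insert_commute)
    qed
  qed
  have w: "0 \<le> r" "r < 2 * n" "(r - r) mod n = 0" using r_ge r_less by simp_all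
  let ?D = "entries - {r, n + r}"
  let ?R = "row r ` ?D" and ?C = "{?b1, ?b2, t1, t2}"
  have oddD: "odd d" if "d \<in> entries" for d using that by (simp add: entries_def)
  have full: "inj_on (label p) (row r ` entries)" for p
    by (rule inj_label_row[OF r order_refl]) (rule separate_reflect[OF _ w(3)])
  have label_f: "label False t1 = Medial m 1" "label False t2 = Medial m 0"
    using t1 t2 label_t(1-4) by (auto simp del: label.simps)
  have label_T: "label True t1 \<in> {rise 0, rise n}" "label True t2 \<in> {rise 0, rise n}" using freed by blast+
  have rows: "label True (row r r) = rise 0" "label True (row r (n + r)) = rise n"
    using label_row(2)[OF r] r n by simp_all
  have ne: "rise 0 \<noteq> rise n"
  proof
    assume "rise 0 = rise n"
    then have "row r r = row r (n + r)"
      using inj_onD[OF full[of True], of "row r r" "row r (n + r)"] rows entr by simp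
    then show False using n_pos by (simp add: row_def)
  qed
  then have label_T12: "label True t1 \<noteq> label True t2" using freed by (metis insert_absorb2 insertCI singletonD)
  have rise_not_Medial: "rise c \<noteq> Medial h x" "Medial h x \<noteq> rise c" for c h x using rise_range[of c] by auto
  have inj: "inj_on (label p) (?R \<union> ?C)" for p
  proof (rule inj_on_UnI)
    show "inj_on (label p) ?R" by (rule inj_on_subset[OF full]) blast
    show "inj_on (label p) ?C"
    proof (cases p)
      case True
      then show ?thesis using label_b(3,4) label_T label_T12 rise_not_Medial unfolding inj_on_def by (auto simp del: label.simps)
    next
      case False
      then show ?thesis using label_b(1,2) label_f n_pos unfolding inj_on_def by (auto simp del: label.simps)
    qed
    show "label p ` ?R \<inter> label p ` ?C = {}"
    proof (cases p)
      case True
      have "label True (row r d) \<noteq> rise 0 \<and> label True (row r d) \<noteq> rise n \<and> label True (row r d) \<in> range rise" if d: "d \<in> ?D" for d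
      proof -
        have "row r d \<noteq> row r r" "row r d \<noteq> row r (n + r)" using d by (simp_all add: row_def)
        then have "label True (row r d) \<noteq> rise 0" "label True (row r d) \<noteq> rise n"
          using inj_onD[OF full[of True], of "row r d" "row r r"] inj_onD[OF full[of True], of "row r d" "row r (n + r)"]
            rows entr d by auto
        then show ?thesis using label_row(2)[OF r] oddD d by simp
      qed
      then show ?thesis using True label_b(3,4) label_T rise_not_Medial by (fastforce simp del: label.simps)
    next
      case False
      have "label False (row r d) = Entry d" if d: "d \<in> ?D" for d
        using label_row(1)[OF r] oddD entry_of_entries d by simp
      then have "label False ` ?R \<subseteq> Entry ` ?D" by blast
      moreover have "label False ` ?C = {Entry r, Entry (n + r), Medial m 1, Medial m 0}"
        using label_b(1,2) label_f by (simp del: label.simps)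
      moreover have "Entry ` ?D \<inter> {Entry r, Entry (n + r), Medial m 1, Medial m 0} = {}" by auto
      ultimately show ?thesis using False by (auto simp del: label.simps)
    qed
  qed
  have card: "card (?R \<union> ?C) = card entries + 2"
  proof -
    have "?R \<inter> ?C = {}" using t1 t2 by (auto simp: row_def)
    moreover have "finite ?R" "finite ?C" using finite_entries by simp_all
    ultimately have "card (?R \<union> ?C) = card ?R + card ?C" by (rule card_Un_disjoint[rotated 2])
    moreover have "card ?R = card ?D" by (rule card_image[OF row_inj])
    moreover have "card ?C = 4"
    proof -
      have "i \<noteq> j" using ij(1) r0 by simp
      then show ?thesis using t1 t2 m0 by auto
    qed
    moreover have "card ?D = card entries - 2" "2 \<le> card entries"
    proof -
      have sub: "{r, n + r} \<subseteq> entries" and two: "card {r, n + r} = 2" using entr n_pos by simp_all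
      then show "card ?D = card entries - 2" using card_Diff_subset[of "{r, n + r}" entries] by simp
      show "2 \<le> card entries" using card_mono[OF finite_entries sub] two by simp
    qed
    ultimately show ?thesis by simp
  qed
  have ex: "card extras = 2" using card_extras_even[OF n] r by simp
  have "independence_number (bishop_graph n n m) = card (Entry ` entries \<union> extras)"
  proof (rule independence_number_eqI[of _ "?R \<union> ?C"])
    show "finite (Entry ` entries \<union> extras)" using finite_entries finite_extras by simp
    show "label False a \<in> Entry ` entries \<union> extras" if "valid a" for a using odd_labels that .
    show "valid a" if "a \<in> ?R \<union> ?C" for a
      using that valid_row[OF w(1,2)] ij(5-8) t1 t2 by auto
    show "inj_on (label p) (?R \<union> ?C)" for p by (rule inj)
    show "card (?R \<union> ?C) = card (Entry ` entries \<union> extras)"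
      unfolding card card_labels ex ..
  qed
  then show ?thesis unfolding card_labels ex by simp
qed

end

text \<open>
  In each of the three parity cases the independence number is the number of odd diagonals, which is evaluated
  by \<open>card_entries\<close>.
\<close>

theorem theorem4p1:
  fixes n k r :: int
  assumes "n \<ge> 1" and "0 \<le> r" and "r < n" and "n \<le> k * n + r"
  shows "let \<beta> = int (independence_number (bishop_graph n n (k * n + r))) in
    (odd k \<and> odd n \<and> r = 0 \<longrightarrow> \<beta> = 2 * n + 4) \<and>
    ((odd k \<and> odd n \<and> r > 0) \<or> (odd k \<and> odd r) \<longrightarrow> \<beta> = 2 * n + 3 - r) \<and>
    (odd k \<and> even n \<and> even r \<longrightarrow> \<beta> = 2 * n - r) \<and>
    (even k \<and> odd n \<and> r = 0 \<longrightarrow> \<beta> = n + 5) \<and>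
    ((even k \<and> odd n \<and> r > 0) \<or> (even k \<and> odd r) \<longrightarrow> \<beta> = n + 3 + r) \<and>
    (even k \<and> even n \<and> even r \<longrightarrow> \<beta> = n + r)"
proof -
  interpret prism n k r using assms by unfold_locales
  define b where "b = int (independence_number (bishop_graph n n m))"
  have b: "b = int (card entries) + (if odd n then if r = 0 then 4 else 2 else if odd r then 2 else 0)"
    using independence_odd independence_even_odd independence_even_even by (cases "odd n"; cases "odd r") (simp_all add: b_def)
  have "r \<noteq> 0 \<longleftrightarrow> r > 0" using assms(2) by linarith
  then show ?thesis
    unfolding Let_def m_def[symmetric] b_def[symmetric] b card_entries by auto
qed

end
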